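(* Let $\Pi$ be a finite set of proposition symbols and $\Delta\in\mathbb{N}$. Given a message passing circuit (MPC) $C$ for $(\Pi,\Delta)$ of size $m$, one can construct a $(\Pi,\Delta)$-program of $\mathrm{MPMSC}$ that is communication equivalent to $C$. Supposing a constant bound $c$ on the fan-in of MPCs (all gates have fan-in at most $c$), the size of the program is linear in the size $m$ of the circuit.
   Context: Proposition symbols: a countably infinite, linearly ordered set partitioned into ordinary and identifier symbols; for finite $\Pi$, $\Pi_1$ denotes its identifier symbols. A Kripke model over $\Pi$ is $M=(W,R,V)$, $W\ne\emptyset$, $R\subseteq W\times W$, $V:\Pi\to\mathcal P(W)$. With $p_1,\dots,p_\ell$ listing $\Pi_1$ in order, $\mathrm{ID}(w)$ is the $\ell$-bit string whose $i$th bit is $1$ iff $w\in V(p_i)$; $M$ has identifiers if $\mathrm{ID}$ is injective. The local input of $w$ is the $|\Pi|$-bit string recording which symbols of $\Pi$ (in order) hold at $w$. $\mathcal K(\Pi,\Delta)$: finite Kripke models over $\Pi$ with identifiers and out-degree at most $\Delta$. If the successors of $w$ have identifiers $s_1<\dots<s_d$ lexicographically, the one with identifier $s_i$ is the $i$th neighbour of $w$. Sequences: for a sequence $(\overline b_n)_n$ of $k$-bit strings and $A,P\subseteq[k]$, the appointed string of round $n$ is the substring of $\overline b_n$ at positions $A\cup P$; the sequence of these is the appointed sequence. Circuits: a Boolean circuit is a DAG with gates labelled $\wedge,\vee$ (any fan-in) or $\neg$ (fan-in 1) except input gates (fan-in 0); inputs and outputs are linearly ordered; size = number of gates. An MPC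 for $(\Pi,\Delta)$ is a circuit computing $\{0,1\}^{|\Pi|+k(\Delta+1)}\to\{0,1\}^k$ with attention and print bit sets $A,P\subseteq[k]$. On $M\in\mathcal K(\Pi,\Delta)$: $f_0(w)=C(\overline t_w\cdot0^{k(\Delta+1)})$ with $\overline t_w$ the local input, and $f_{n+1}(w)=C(\overline t_w\cdot f_n(w)\cdot f_n(v_1)\cdots f_n(v_m)\cdot (0^k)^{\Delta-m})$, $v_1,\dots,v_m$ the neighbours of $w$ in order. The appointed sequence of $C$ at $w$ is that of $(f_n(w))_n$ w.r.t. $(k,A,P)$. MPMSC: schemata over $\Pi$ and a set of schema variables are built by $\varphi::=\top\mid p\mid X\mid\neg\varphi\mid(\varphi\wedge\varphi)\mid\Diamond_i\varphi$ ($p\in\Pi$, $X$ a schema variable, $i\in[\Delta]$), where $\Diamond_i\varphi$ holds at $w$ iff $w$ has an $i$th neighbour and $\varphi$ holds there. A $(\Pi,\Delta)$-program of MPMSC has distinct head predicates $Y_1,\dots,Y_k$ (fixed order), a terminal clause $Y_i(0):=\varphi_i$ for each $i$ with $\varphi_i$ diamond- and variable-free, and for each $i$ an iteration clause which is either standard, $Y_i:=\psi$, or conditional, $Y_i:=_{\varphi_1,\dots,\varphi_n}\psi_1;\dots;\psi_n;\chi$, where conditions $\varphi_j$ have modal depth $0$ and $\psi,\psi_j,\chi$ have modal depth at most $1$ (all schemata over $\{Y_1,\dots,Y_k\}$); plus sets of attention and print predicates among the heads. Semantics: $Y_i^0=\varphi_i$; for a standard clause $Y_i^{n+1}=\psi^{n+1}$,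 and for a conditional clause $Y_i^{n+1}=\bigvee_{j\le n}\big(\bigwedge_{j'<j}\neg\varphi_{j'}^{n+1}\wedge\varphi_j^{n+1}\wedge\psi_j^{n+1}\big)\vee\big(\bigwedge_{j\le n}\neg\varphi_j^{n+1}\wedge\chi^{n+1}\big)$, where $\theta^{n+1}$ denotes $\theta$ with each $Y_j$ replaced by $Y_j^n$. The round-$n$ configuration at $w$ is the $k$-bit string whose $i$th bit is $1$ iff $(M,w)\models Y_i^n$; the appointed string of round $n$ is its restriction to the positions of attention and print predicates. A condition $\varphi_j$ is hot at $w$ in round $n\ge1$ if $\varphi_j^n$ holds at $w$ and no earlier $\varphi_{j'}^n$ ($j'<j$) does; otherwise the backup is hot. A communication clause is an iteration clause containing a diamond; it is broadcasting at $w$ in round $n\ge1$ if a hot condition's consequence contains a diamond, or the backup is hot and contains a diamond, or the clause is standard and contains a diamond. A global communication round of the program on $M$ is a round $n\ge1$ in which some communication clause is broadcasting at some node of $M$. Size = number of occurrences of proposition symbols, head predicates, $\top,\neg,\wedge,\Diamond_i$. Communication equivalence: a program $\Lambda$ of MPMSC and an MPC $C$ for $(\Pi,\Delta)$ are (strongly) communication equivalent if for every $M\in\mathcal K(\Pi,\Delta)$ interpreting all symbols of $\Lambda$ and every node $w$, the appointed sequence of $C$ at $w$ equals the sequence $(\overline r_j)_{j\in\{0\}\cup G}$ of appointed strings of $\Lambda$ at $w$, where $G$ is the set of global communication rounds of $\Lambda$ on $M$.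
   Formalization: Δ ≥ 1 is assumed: for Δ = 0 there are no diamonds, so no communication rounds, and the claim fails. The constants of the linear bound may depend on Π, Δ and c (a bound uniform in Π fails for parity). Models have natural numbers as nodes, which covers all finite models up to isomorphism. *)

theory Defs
  imports
    "HOL-Library.Countable"
    "HOL-Library.Infinite_Set"
    "HOL-Library.List_Lexorder"
begin

text \<open>
  Proposition symbols are the elements of a linearly ordered type; \<open>IDS\<close> is the set of identifier
  symbols, all other symbols being ordinary. Bit strings are Boolean lists, and bit positions,
  head predicates and neighbours in a list are counted from 0, so that \<open>[k]\<close> becomes \<open>{..<k}\<close>.
\<close>

section \<open>Kripke models with identifiers\<close>

record ('w, 'p) kripke =
  worlds :: "'w set"
  accessible :: "('w \<times> 'w) set"
  val :: "'p \<Rightarrow> 'w set"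

definition kripke_model :: "'p set \<Rightarrow> ('w, 'p) kripke \<Rightarrow> bool" where
  "kripke_model \<Pi> M \<longleftrightarrow> worlds M \<noteq> {} \<and> accessible M \<subseteq> worlds M \<times> worlds M \<and>
     (\<forall>p\<in>\<Pi>. val M p \<subseteq> worlds M)"

definition local_input :: "'p::linorder set \<Rightarrow> ('w, 'p) kripke \<Rightarrow> 'w \<Rightarrow> bool list" where
  "local_input \<Pi> M w = map (\<lambda>p. w \<in> val M p) (sorted_list_of_set \<Pi>)"

definition ID :: "'p::linorder set \<Rightarrow> 'p set \<Rightarrow> ('w, 'p) kripke \<Rightarrow> 'w \<Rightarrow> bool list" where
  "ID IDS \<Pi> M w = map (\<lambda>p. w \<in> val M p) (sorted_list_of_set (\<Pi> \<inter> IDS))"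

definition has_identifiers :: "'p::linorder set \<Rightarrow> 'p set \<Rightarrow> ('w, 'p) kripke \<Rightarrow> bool" where
  "has_identifiers IDS \<Pi> M \<longleftrightarrow> inj_on (ID IDS \<Pi> M) (worlds M)"

definition model_class :: "'p::linorder set \<Rightarrow> 'p set \<Rightarrow> nat \<Rightarrow> ('w, 'p) kripke set" where
  "model_class IDS \<Pi> \<Delta> =
     {M. kripke_model \<Pi> M \<and> finite (worlds M) \<and> has_identifiers IDS \<Pi> M \<and>
         (\<forall>w\<in>worlds M. card (accessible M `` {w}) \<le> \<Delta>)}"

text \<open>The order on identifiers is the lexicographic one of \<^theory>\<open>HOL-Library.List_Lexorder\<close>,
  with \<^prop>\<open>False < True\<close>.\<close>

definition neighbours :: "'p::linorder set \<Rightarrow> 'p set \<Rightarrow> ('w, 'p) kripke \<Rightarrow> 'w \<Rightarrow> 'w list" where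
  "neighbours IDS \<Pi> M w = sorted_key_list_of_set (ID IDS \<Pi> M) (accessible M `` {w})"


section \<open>Boolean circuits\<close>

datatype gate_label = AndGate | OrGate | NotGate

text \<open>An edge \<open>(h, g)\<close> means that the value of \<open>h\<close> is fed into \<open>g\<close>. The labels of input gates are
  irrelevant. A non-input gate without predecessors is a conjunction or disjunction of fan-in 0,
  that is, a constant.\<close>

record 'g circuit =
  gates :: "'g set"
  edges :: "('g \<times> 'g) set"
  label :: "'g \<Rightarrow> gate_label"
  inputs :: "'g list"
  outputs :: "'g list"

definition fan_in :: "('g, 'a) circuit_scheme \<Rightarrow> 'g \<Rightarrow> nat" where
  "fan_in C g = card {h. (h, g) \<in> edges C}"

definition is_circuit :: "('g, 'a) circuit_scheme \<Rightarrow> bool" where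
  "is_circuit C \<longleftrightarrow>
     finite (gates C) \<and> edges C \<subseteq> gates C \<times> gates C \<and> acyclic (edges C) \<and>
     distinct (inputs C) \<and> set (inputs C) \<subseteq> gates C \<and>
     distinct (outputs C) \<and> set (outputs C) \<subseteq> gates C \<and>
     (\<forall>g\<in>set (inputs C). fan_in C g = 0) \<and>
     (\<forall>g\<in>gates C - set (inputs C). label C g = NotGate \<longrightarrow> fan_in C g = 1)"

definition circuit_size :: "('g, 'a) circuit_scheme \<Rightarrow> nat" where
  "circuit_size C = card (gates C)"

definition gate_step ::
  "('g, 'a) circuit_scheme \<Rightarrow> bool list \<Rightarrow> ('g \<Rightarrow> bool) \<Rightarrow> 'g \<Rightarrow> bool" where
  "gate_step C bs v g =
     (if g \<in> set (inputs C) then the (map_of (zip (inputs C) bs) g)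
      else case label C g of
        AndGate \<Rightarrow> \<forall>h. (h, g) \<in> edges C \<longrightarrow> v h
      | OrGate \<Rightarrow> \<exists>h. (h, g) \<in> edges C \<and> v h
      | NotGate \<Rightarrow> \<exists>h. (h, g) \<in> edges C \<and> \<not> v h)"

definition gate_value :: "('g, 'a) circuit_scheme \<Rightarrow> bool list \<Rightarrow> 'g \<Rightarrow> bool" where
  "gate_value C bs = wfrec (edges C) (gate_step C bs)"

definition circuit_output :: "('g, 'a) circuit_scheme \<Rightarrow> bool list \<Rightarrow> bool list" where
  "circuit_output C bs = map (gate_value C bs) (outputs C)"

lemma gate_value_unfold:
  assumes "is_circuit C"
  shows "gate_value C bs g = gate_step C bs (gate_value C bs) g"
proof -
  have "finite (edges C)"
    using assms by (auto simp: is_circuit_def intro: finite_subset)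
  with assms have wf: "wf (edges C)"
    by (simp add: is_circuit_def finite_acyclic_wf)
  have cut: "gate_step C bs (cut v (edges C) g) g = gate_step C bs v g" for v
    by (auto simp: gate_step_def cut_apply split: gate_label.split)
  show ?thesis
    unfolding gate_value_def by (subst wfrec[OF wf]) (simp add: cut)
qed


section \<open>Message passing circuits\<close>

record 'g mpc = "'g circuit" +
  attention_bits :: "nat set"
  print_bits :: "nat set"

definition state_length :: "('g, 'a) mpc_scheme \<Rightarrow> nat" where
  "state_length C = length (outputs C)"

definition is_mpc :: "'p set \<Rightarrow> nat \<Rightarrow> 'g mpc \<Rightarrow> bool" where
  "is_mpc \<Pi> \<Delta> C \<longleftrightarrow> is_circuit C \<and>
     length (inputs C) = card \<Pi> + state_length C * (\<Delta> + 1) \<and>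
     attention_bits C \<subseteq> {..<state_length C} \<and> print_bits C \<subseteq> {..<state_length C}"

fun mpc_state ::
  "'p::linorder set \<Rightarrow> 'p set \<Rightarrow> nat \<Rightarrow> 'g mpc \<Rightarrow> ('w, 'p) kripke \<Rightarrow> nat \<Rightarrow> 'w \<Rightarrow> bool list"
where
  "mpc_state IDS \<Pi> \<Delta> C M 0 w =
     circuit_output C (local_input \<Pi> M w @ replicate (state_length C * (\<Delta> + 1)) False)"
| "mpc_state IDS \<Pi> \<Delta> C M (Suc n) w =
     circuit_output C
       (local_input \<Pi> M w @ mpc_state IDS \<Pi> \<Delta> C M n w @
        concat (map (mpc_state IDS \<Pi> \<Delta> C M n) (neighbours IDS \<Pi> M w)) @
        replicate (state_length C * (\<Delta> - length (neighbours IDS \<Pi> M w))) False)"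

definition mpc_appointed ::
  "'p::linorder set \<Rightarrow> 'p set \<Rightarrow> nat \<Rightarrow> 'g mpc \<Rightarrow> ('w, 'p) kripke \<Rightarrow> 'w \<Rightarrow> nat \<Rightarrow> bool list"
where
  "mpc_appointed IDS \<Pi> \<Delta> C M w n =
     nths (mpc_state IDS \<Pi> \<Delta> C M n w) (attention_bits C \<union> print_bits C)"


section \<open>The logic MPMSC\<close>

subsection \<open>Schemata\<close>

text \<open>Schema variables are natural numbers. \<open>Dia i\<close> uses the numbering of neighbours that starts
  at 1.\<close>

datatype 'p schema =
    Top
  | Prop 'p
  | SVar nat
  | Neg "'p schema"
  | Conj "'p schema" "'p schema"
  | Dia nat "'p schema"

fun schema_props :: "'p schema \<Rightarrow> 'p set" where
  "schema_props Top = {}"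
| "schema_props (Prop p) = {p}"
| "schema_props (SVar X) = {}"
| "schema_props (Neg \<phi>) = schema_props \<phi>"
| "schema_props (Conj \<phi> \<psi>) = schema_props \<phi> \<union> schema_props \<psi>"
| "schema_props (Dia i \<phi>) = schema_props \<phi>"

fun schema_vars :: "'p schema \<Rightarrow> nat set" where
  "schema_vars Top = {}"
| "schema_vars (Prop p) = {}"
| "schema_vars (SVar X) = {X}"
| "schema_vars (Neg \<phi>) = schema_vars \<phi>"
| "schema_vars (Conj \<phi> \<psi>) = schema_vars \<phi> \<union> schema_vars \<psi>"
| "schema_vars (Dia i \<phi>) = schema_vars \<phi>"

fun schema_dias :: "'p schema \<Rightarrow> nat set" where
  "schema_dias Top = {}"
| "schema_dias (Prop p) = {}"
| "schema_dias (SVar X) = {}"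
| "schema_dias (Neg \<phi>) = schema_dias \<phi>"
| "schema_dias (Conj \<phi> \<psi>) = schema_dias \<phi> \<union> schema_dias \<psi>"
| "schema_dias (Dia i \<phi>) = insert i (schema_dias \<phi>)"

fun modal_depth :: "'p schema \<Rightarrow> nat" where
  "modal_depth Top = 0"
| "modal_depth (Prop p) = 0"
| "modal_depth (SVar X) = 0"
| "modal_depth (Neg \<phi>) = modal_depth \<phi>"
| "modal_depth (Conj \<phi> \<psi>) = max (modal_depth \<phi>) (modal_depth \<psi>)"
| "modal_depth (Dia i \<phi>) = Suc (modal_depth \<phi>)"

fun schema_size :: "'p schema \<Rightarrow> nat" where
  "schema_size Top = 1"
| "schema_size (Prop p) = 1"
| "schema_size (SVar X) = 1"
| "schema_size (Neg \<phi>) = schema_size \<phi> + 1"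
| "schema_size (Conj \<phi> \<psi>) = schema_size \<phi> + schema_size \<psi> + 1"
| "schema_size (Dia i \<phi>) = schema_size \<phi> + 1"

fun subst :: "(nat \<Rightarrow> 'p schema) \<Rightarrow> 'p schema \<Rightarrow> 'p schema" where
  "subst \<sigma> Top = Top"
| "subst \<sigma> (Prop p) = Prop p"
| "subst \<sigma> (SVar X) = \<sigma> X"
| "subst \<sigma> (Neg \<phi>) = Neg (subst \<sigma> \<phi>)"
| "subst \<sigma> (Conj \<phi> \<psi>) = Conj (subst \<sigma> \<phi>) (subst \<sigma> \<psi>)"
| "subst \<sigma> (Dia i \<phi>) = Dia i (subst \<sigma> \<phi>)"

definition schema_over :: "'p set \<Rightarrow> nat set \<Rightarrow> nat \<Rightarrow> 'p schema \<Rightarrow> bool" where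
  "schema_over \<Pi> Vars \<Delta> \<phi> \<longleftrightarrow>
     schema_props \<phi> \<subseteq> \<Pi> \<and> schema_vars \<phi> \<subseteq> Vars \<and> schema_dias \<phi> \<subseteq> {1..\<Delta>}"

text \<open>Only variable-free schemata are ever evaluated; the equation for variables merely makes the
  function total.\<close>

fun sat :: "'p::linorder set \<Rightarrow> 'p set \<Rightarrow> ('w, 'p) kripke \<Rightarrow> 'w \<Rightarrow> 'p schema \<Rightarrow> bool" where
  "sat IDS \<Pi> M w Top \<longleftrightarrow> True"
| "sat IDS \<Pi> M w (Prop p) \<longleftrightarrow> w \<in> val M p"
| "sat IDS \<Pi> M w (SVar X) \<longleftrightarrow> False"
| "sat IDS \<Pi> M w (Neg \<phi>) \<longleftrightarrow> \<not> sat IDS \<Pi> M w \<phi>"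
| "sat IDS \<Pi> M w (Conj \<phi> \<psi>) \<longleftrightarrow> sat IDS \<Pi> M w \<phi> \<and> sat IDS \<Pi> M w \<psi>"
| "sat IDS \<Pi> M w (Dia i \<phi>) \<longleftrightarrow>
     1 \<le> i \<and> i \<le> length (neighbours IDS \<Pi> M w) \<and> sat IDS \<Pi> M (neighbours IDS \<Pi> M w ! (i - 1)) \<phi>"

definition Disj :: "'p schema \<Rightarrow> 'p schema \<Rightarrow> 'p schema" where
  "Disj \<phi> \<psi> = Neg (Conj (Neg \<phi>) (Neg \<psi>))"

definition BigConj :: "'p schema list \<Rightarrow> 'p schema" where
  "BigConj \<phi>s = foldr Conj \<phi>s Top"

definition BigDisj :: "'p schema list \<Rightarrow> 'p schema" where
  "BigDisj \<phi>s = foldr Disj \<phi>s (Neg Top)"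

subsection \<open>Programs\<close>

text \<open>\<open>Conditional [(\<phi>\<^sub>1, \<psi>\<^sub>1), \<dots>, (\<phi>\<^sub>n, \<psi>\<^sub>n)] \<chi>\<close> has conditions \<open>\<phi>\<^sub>j\<close>, consequences \<open>\<psi>\<^sub>j\<close> and
  backup \<open>\<chi>\<close>.\<close>

datatype 'p iteration_clause =
    Standard "'p schema"
  | Conditional "('p schema \<times> 'p schema) list" "'p schema"

text \<open>The head predicates of a program with \<open>k\<close> heads are the schema variables \<open>0, \<dots>, k - 1\<close> in
  this order. The \<open>i\<close>-th pair in \<open>clauses\<close> consists of the body of the terminal clause and the
  iteration clause of head \<open>i\<close>.\<close>

record 'p program =
  clauses :: "('p schema \<times> 'p iteration_clause) list"
  attention_heads :: "nat set"
  print_heads :: "nat set"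

definition num_heads :: "'p program \<Rightarrow> nat" where
  "num_heads \<Lambda> = length (clauses \<Lambda>)"

definition terminal_body :: "'p program \<Rightarrow> nat \<Rightarrow> 'p schema" where
  "terminal_body \<Lambda> i = fst (clauses \<Lambda> ! i)"

definition iteration_clause :: "'p program \<Rightarrow> nat \<Rightarrow> 'p iteration_clause" where
  "iteration_clause \<Lambda> i = snd (clauses \<Lambda> ! i)"

fun iteration_clause_ok :: "'p set \<Rightarrow> nat \<Rightarrow> nat \<Rightarrow> 'p iteration_clause \<Rightarrow> bool" where
  "iteration_clause_ok \<Pi> \<Delta> k (Standard \<psi>) \<longleftrightarrow>
     schema_over \<Pi> {..<k} \<Delta> \<psi> \<and> modal_depth \<psi> \<le> 1"
| "iteration_clause_ok \<Pi> \<Delta> k (Conditional cs \<chi>) \<longleftrightarrow>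
     cs \<noteq> [] \<and>
     (\<forall>(\<phi>, \<psi>)\<in>set cs. schema_over \<Pi> {..<k} \<Delta> \<phi> \<and> modal_depth \<phi> = 0 \<and>
                      schema_over \<Pi> {..<k} \<Delta> \<psi> \<and> modal_depth \<psi> \<le> 1) \<and>
     schema_over \<Pi> {..<k} \<Delta> \<chi> \<and> modal_depth \<chi> \<le> 1"

definition is_program :: "'p set \<Rightarrow> nat \<Rightarrow> 'p program \<Rightarrow> bool" where
  "is_program \<Pi> \<Delta> \<Lambda> \<longleftrightarrow>
     (\<forall>i<num_heads \<Lambda>. schema_over \<Pi> {} \<Delta> (terminal_body \<Lambda> i) \<and>
                      modal_depth (terminal_body \<Lambda> i) = 0 \<and>
                      iteration_clause_ok \<Pi> \<Delta> (num_heads \<Lambda>) (iteration_clause \<Lambda> i)) \<and>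
     attention_heads \<Lambda> \<subseteq> {..<num_heads \<Lambda>} \<and> print_heads \<Lambda> \<subseteq> {..<num_heads \<Lambda>}"

fun iteration_body_size :: "'p iteration_clause \<Rightarrow> nat" where
  "iteration_body_size (Standard \<psi>) = schema_size \<psi>"
| "iteration_body_size (Conditional cs \<chi>) =
     (\<Sum>(\<phi>, \<psi>)\<leftarrow>cs. schema_size \<phi> + schema_size \<psi>) + schema_size \<chi>"

text \<open>The summand 2 counts the occurrences of the head on the left-hand sides of its two clauses.\<close>

definition program_size :: "'p program \<Rightarrow> nat" where
  "program_size \<Lambda> = (\<Sum>(\<phi>, cl)\<leftarrow>clauses \<Lambda>. schema_size \<phi> + iteration_body_size cl + 2)"

subsection \<open>Semantics of programs\<close>

fun clause_formula :: "(nat \<Rightarrow> 'p schema) \<Rightarrow> 'p iteration_clause \<Rightarrow> 'p schema" where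
  "clause_formula \<sigma> (Standard \<psi>) = subst \<sigma> \<psi>"
| "clause_formula \<sigma> (Conditional cs \<chi>) =
     Disj
       (BigDisj
         (map (\<lambda>j. Conj (BigConj (map (\<lambda>(\<phi>, \<psi>). Neg (subst \<sigma> \<phi>)) (take j cs)))
                        (Conj (subst \<sigma> (fst (cs ! j))) (subst \<sigma> (snd (cs ! j)))))
           [0..<length cs]))
       (Conj (BigConj (map (\<lambda>(\<phi>, \<psi>). Neg (subst \<sigma> \<phi>)) cs)) (subst \<sigma> \<chi>))"

fun head_formula :: "'p program \<Rightarrow> nat \<Rightarrow> nat \<Rightarrow> 'p schema" where
  "head_formula \<Lambda> 0 i = terminal_body \<Lambda> i"
| "head_formula \<Lambda> (Suc n) i = clause_formula (head_formula \<Lambda> n) (iteration_clause \<Lambda> i)"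

definition configuration ::
  "'p::linorder set \<Rightarrow> 'p set \<Rightarrow> 'p program \<Rightarrow> ('w, 'p) kripke \<Rightarrow> nat \<Rightarrow> 'w \<Rightarrow> bool list" where
  "configuration IDS \<Pi> \<Lambda> M n w =
     map (\<lambda>i. sat IDS \<Pi> M w (head_formula \<Lambda> n i)) [0..<num_heads \<Lambda>]"

definition program_appointed ::
  "'p::linorder set \<Rightarrow> 'p set \<Rightarrow> 'p program \<Rightarrow> ('w, 'p) kripke \<Rightarrow> 'w \<Rightarrow> nat \<Rightarrow> bool list" where
  "program_appointed IDS \<Pi> \<Lambda> M w n =
     nths (configuration IDS \<Pi> \<Lambda> M n w) (attention_heads \<Lambda> \<union> print_heads \<Lambda>)"

subsection \<open>Global communication rounds\<close>

definition contains_diamond :: "'p schema \<Rightarrow> bool" where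
  "contains_diamond \<phi> \<longleftrightarrow> schema_dias \<phi> \<noteq> {}"

fun communication_clause :: "'p iteration_clause \<Rightarrow> bool" where
  "communication_clause (Standard \<psi>) \<longleftrightarrow> contains_diamond \<psi>"
| "communication_clause (Conditional cs \<chi>) \<longleftrightarrow>
     (\<exists>(\<phi>, \<psi>)\<in>set cs. contains_diamond \<phi> \<or> contains_diamond \<psi>) \<or> contains_diamond \<chi>"

text \<open>In the next three definitions \<open>\<sigma>\<close> stands for the head formulas of the preceding round, so
  that \<^term>\<open>subst \<sigma> \<phi>\<close> is the formula \<open>\<phi>\<^sup>n\<close> when the notion is applied to round \<open>n \<ge> 1\<close>.\<close>

definition hot_condition ::
  "'p::linorder set \<Rightarrow> 'p set \<Rightarrow> ('w, 'p) kripke \<Rightarrow> 'w \<Rightarrow> (nat \<Rightarrow> 'p schema) \<Rightarrow>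
   ('p schema \<times> 'p schema) list \<Rightarrow> nat \<Rightarrow> bool" where
  "hot_condition IDS \<Pi> M w \<sigma> cs j \<longleftrightarrow> j < length cs \<and> sat IDS \<Pi> M w (subst \<sigma> (fst (cs ! j))) \<and>
     (\<forall>j'<j. \<not> sat IDS \<Pi> M w (subst \<sigma> (fst (cs ! j'))))"

definition hot_backup ::
  "'p::linorder set \<Rightarrow> 'p set \<Rightarrow> ('w, 'p) kripke \<Rightarrow> 'w \<Rightarrow> (nat \<Rightarrow> 'p schema) \<Rightarrow>
   ('p schema \<times> 'p schema) list \<Rightarrow> bool" where
  "hot_backup IDS \<Pi> M w \<sigma> cs \<longleftrightarrow> (\<forall>j<length cs. \<not> sat IDS \<Pi> M w (subst \<sigma> (fst (cs ! j))))"

fun broadcasting ::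
  "'p::linorder set \<Rightarrow> 'p set \<Rightarrow> ('w, 'p) kripke \<Rightarrow> 'w \<Rightarrow> (nat \<Rightarrow> 'p schema) \<Rightarrow>
   'p iteration_clause \<Rightarrow> bool" where
  "broadcasting IDS \<Pi> M w \<sigma> (Standard \<psi>) \<longleftrightarrow> contains_diamond \<psi>"
| "broadcasting IDS \<Pi> M w \<sigma> (Conditional cs \<chi>) \<longleftrightarrow>
     (\<exists>j. hot_condition IDS \<Pi> M w \<sigma> cs j \<and> contains_diamond (snd (cs ! j))) \<or>
     (hot_backup IDS \<Pi> M w \<sigma> cs \<and> contains_diamond \<chi>)"

definition global_rounds ::
  "'p::linorder set \<Rightarrow> 'p set \<Rightarrow> 'p program \<Rightarrow> ('w, 'p) kripke \<Rightarrow> nat set" where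
  "global_rounds IDS \<Pi> \<Lambda> M =
     {n. 1 \<le> n \<and> (\<exists>w\<in>worlds M. \<exists>i<num_heads \<Lambda>. communication_clause (iteration_clause \<Lambda> i) \<and>
            broadcasting IDS \<Pi> M w (head_formula \<Lambda> (n - 1)) (iteration_clause \<Lambda> i))}"


section \<open>Communication equivalence\<close>

text \<open>Two sequences are equal only if they have the same length. The appointed sequence of a circuit
  is infinite, hence so must be the set of rounds indexing the appointed sequence of the program.
  As the models in question are finite, taking the natural numbers as the type of worlds covers all
  of them up to isomorphism.\<close>

definition communication_equivalent ::
  "'p::linorder set \<Rightarrow> 'p set \<Rightarrow> nat \<Rightarrow> 'p program \<Rightarrow> 'g mpc \<Rightarrow> bool" where
  "communication_equivalent IDS \<Pi> \<Delta> \<Lambda> C \<longleftrightarrow>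
     (\<forall>M :: (nat, 'p) kripke. M \<in> model_class IDS \<Pi> \<Delta> \<longrightarrow>
        (\<forall>w\<in>worlds M.
           let S = {0} \<union> global_rounds IDS \<Pi> \<Lambda> M
           in infinite S \<and>
              (\<forall>n. mpc_appointed IDS \<Pi> \<Delta> C M w n =
                   program_appointed IDS \<Pi> \<Lambda> M w (enumerate S n))))"

end

theory Submission
  imports Defs
begin

text \<open>
  Round \<open>n + 1\<close> of the circuit has to be displayed in the very round in which the messages sent after
  round \<open>n\<close> arrive, so there is no time to evaluate the circuit on received messages. But \<open>\<Pi>\<close> is
  fixed and identifiers are injective, so there are only finitely many pointed models up to
  isomorphism, a number that counts as a constant. Every node simulates the circuit on all of them
  without any communication, gate by gate, during a clock period exceeding the number of gates.
  When the clock ticks, nodes exchange only the information which pointed models \<open>x\<close> they cannot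
  tell apart from their own within \<open>n\<close> rounds; the \<open>(n + 1)\<close>-round version of this relation is
  defined by a formula of modal depth 1 and constant size. The output bit \<open>j\<close> is then the
  disjunction over all \<open>x\<close> of this formula for \<open>x\<close> together with the precomputed bit \<open>j\<close> of \<open>x\<close>.
\<close>

section \<open>Preliminaries\<close>

text \<open>Here \<open>f\<close> will be multiplication by the clock period, which makes the
  \<open>n\<close>-th communication round explicit. By monotonicity the least element of the range
  above \<open>f n\<close> is \<open>f (Suc n)\<close>.\<close>

lemma enumerate_range:
  fixes f :: "nat \<Rightarrow> nat"
  assumes "strict_mono f"
  shows "infinite (range f)" "enumerate (range f) n = f n"
proof -
  show inf: "infinite (range f)"
    using assms by (simp add: finite_image_iff strict_mono_imp_inj_on)
  show "enumerate (range f) n = f n"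
  proof (induction n)
    case 0
    show ?case
      unfolding enumerate_0
      by (rule Least_equality) (auto simp: strict_mono_less_eq[OF assms])
  next
    case (Suc n)
    show ?case
      unfolding enumerate_Suc''[OF inf] Suc
      by (rule Least_equality)
        (auto simp: strict_mono_less[OF assms] strict_mono_less_eq[OF assms])
  qed
qed

text \<open>For an element outside the list this returns the length, an invalid position; hence the
  membership premises below.\<close>

definition index :: "'a list \<Rightarrow> 'a \<Rightarrow> nat" where
  "index xs y = length (takeWhile (\<lambda>z. z \<noteq> y) xs)"

lemma index_less:
  assumes "y \<in> set xs"
  shows "index xs y < length xs"
  using assms unfolding index_def by (induction xs) auto

lemma nth_index:
  assumes "y \<in> set xs"
  shows "xs ! index xs y = y"
  using assms unfolding index_def by (induction xs) auto

text \<open>Decodes a position in a concatenation of equally long states: the quotient selects the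
  node, the remainder the bit.\<close>

lemma nth_concat_uniform:
  assumes "\<And>xs. xs \<in> set xss \<Longrightarrow> length xs = k" "r < k * length xss"
  shows "concat xss ! r = xss ! (r div k) ! (r mod k)"
  using assms
proof (induction xss arbitrary: r)
  case Nil
  then show ?case by simp
next
  case (Cons xs xss)
  then have k: "k > 0" and len: "length xs = k" by (auto intro: Nat.gr0I)
  show ?case
  proof (cases "r < k")
    case True
    with len show ?thesis by (simp add: nth_append)
  next
    case False
    with Cons.prems(2) have "r - k < k * length xss" by (auto simp: algebra_simps)
    from Cons.IH[OF _ this] Cons.prems(1)
    have "concat xss ! (r - k) = xss ! ((r - k) div k) ! ((r - k) mod k)" by auto
    moreover have "r div k = Suc ((r - k) div k)" "r mod k = (r - k) mod k"
      using False k by (simp_all add: le_div_geq le_mod_geq)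
    ultimately show ?thesis
      using len False by (simp add: nth_append)
  qed
qed

lemma sum_list_map_le:
  fixes f :: "'a \<Rightarrow> nat"
  assumes "\<And>x. x \<in> set xs \<Longrightarrow> f x \<le> s"
  shows "sum_list (map f xs) \<le> length xs * s"
  using assms by (induction xs) (auto intro: add_mono)

text \<open>The quotient counts simulated circuit rounds and the remainder is the clock reading,
  which wraps at \<open>L - 1\<close>.\<close>

lemma div_mod_Suc:
  fixes t L :: nat
  assumes "L > 0"
  shows "Suc t div L = (if t mod L = L - 1 then Suc (t div L) else t div L)"
    and "Suc t mod L = (if t mod L = L - 1 then 0 else Suc (t mod L))"
proof -
  have "Suc (t mod L) = L \<longleftrightarrow> t mod L = L - 1" using assms by auto
  then show "Suc t div L = (if t mod L = L - 1 then Suc (t div L) else t div L)"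
    and "Suc t mod L = (if t mod L = L - 1 then 0 else Suc (t mod L))"
    by (simp_all add: div_Suc mod_Suc)
qed

section \<open>Schemata and clauses\<close>

lemma sat_BigConj [simp]:
  "sat IDS \<Pi> M w (BigConj xs) \<longleftrightarrow> (\<forall>\<phi>\<in>set xs. sat IDS \<Pi> M w \<phi>)"
  by (induction xs) (auto simp: BigConj_def)

lemma sat_BigDisj [simp]:
  "sat IDS \<Pi> M w (BigDisj xs) \<longleftrightarrow> (\<exists>\<phi>\<in>set xs. sat IDS \<Pi> M w \<phi>)"
  by (induction xs) (auto simp: BigDisj_def Disj_def)

lemma subst_BigConj [simp]: "subst \<sigma> (BigConj xs) = BigConj (map (subst \<sigma>) xs)"
  by (induction xs) (auto simp: BigConj_def)

lemma subst_BigDisj [simp]: "subst \<sigma> (BigDisj xs) = BigDisj (map (subst \<sigma>) xs)"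
  by (induction xs) (auto simp: BigDisj_def Disj_def)

lemma subst_closed: "schema_vars \<phi> = {} \<Longrightarrow> subst \<sigma> \<phi> = \<phi>"
  by (induction \<phi>) auto

lemma schema_vars_BigConj [simp]: "schema_vars (BigConj xs) = (\<Union>\<phi>\<in>set xs. schema_vars \<phi>)"
  by (induction xs) (auto simp: BigConj_def)

lemma schema_dias_BigConj [simp]: "schema_dias (BigConj xs) = (\<Union>\<phi>\<in>set xs. schema_dias \<phi>)"
  by (induction xs) (auto simp: BigConj_def)

lemma schema_dias_BigDisj [simp]: "schema_dias (BigDisj xs) = (\<Union>\<phi>\<in>set xs. schema_dias \<phi>)"
  by (induction xs) (auto simp: BigDisj_def Disj_def)

lemma schema_over_BigConj:
  "schema_over \<Pi> X \<Delta> (BigConj xs) \<longleftrightarrow> (\<forall>\<phi>\<in>set xs. schema_over \<Pi> X \<Delta> \<phi>)"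
  by (induction xs) (auto simp: BigConj_def schema_over_def)

lemma schema_over_BigDisj:
  "schema_over \<Pi> X \<Delta> (BigDisj xs) \<longleftrightarrow> (\<forall>\<phi>\<in>set xs. schema_over \<Pi> X \<Delta> \<phi>)"
  by (induction xs) (auto simp: BigDisj_def Disj_def schema_over_def)

lemma schema_over_simps [simp]:
  "schema_over \<Pi> X \<Delta> Top"
  "schema_over \<Pi> X \<Delta> (Prop p) \<longleftrightarrow> p \<in> \<Pi>"
  "schema_over \<Pi> X \<Delta> (SVar i) \<longleftrightarrow> i \<in> X"
  "schema_over \<Pi> X \<Delta> (Neg \<phi>) \<longleftrightarrow> schema_over \<Pi> X \<Delta> \<phi>"
  "schema_over \<Pi> X \<Delta> (Conj \<phi> \<psi>) \<longleftrightarrow> schema_over \<Pi> X \<Delta> \<phi> \<and> schema_over \<Pi> X \<Delta> \<psi>"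
  "schema_over \<Pi> X \<Delta> (Dia i \<phi>) \<longleftrightarrow> i \<in> {1..\<Delta>} \<and> schema_over \<Pi> X \<Delta> \<phi>"
  by (auto simp: schema_over_def)

lemma modal_depth_BigConj: "modal_depth (BigConj xs) \<le> d \<longleftrightarrow> (\<forall>\<phi>\<in>set xs. modal_depth \<phi> \<le> d)"
  by (induction xs) (auto simp: BigConj_def)

lemma modal_depth_BigDisj: "modal_depth (BigDisj xs) \<le> d \<longleftrightarrow> (\<forall>\<phi>\<in>set xs. modal_depth \<phi> \<le> d)"
  by (induction xs) (auto simp: BigDisj_def Disj_def)

lemma modal_depth_0_iff: "modal_depth \<phi> = 0 \<longleftrightarrow> schema_dias \<phi> = {}"
  by (induction \<phi>) auto

lemma schema_size_BigConj:
  assumes "\<And>x. x \<in> set xs \<Longrightarrow> schema_size (f x) \<le> s"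
  shows "schema_size (BigConj (map f xs)) \<le> length xs * (s + 1) + 1"
  using assms by (induction xs) (force simp: BigConj_def)+

lemma schema_size_BigDisj:
  assumes "\<And>x. x \<in> set xs \<Longrightarrow> schema_size (f x) \<le> s"
  shows "schema_size (BigDisj (map f xs)) \<le> length xs * (s + 4) + 2"
  using assms by (induction xs) (force simp: BigDisj_def Disj_def)+

text \<open>Every conditional clause of the simulator has a single condition, so its semantics is an
  if-then-else.\<close>

lemma sat_clause_formula_if:
  "sat IDS \<Pi> M w (clause_formula \<sigma> (Conditional [(\<phi>, \<psi>)] \<chi>)) \<longleftrightarrow>
     (if sat IDS \<Pi> M w (subst \<sigma> \<phi>) then sat IDS \<Pi> M w (subst \<sigma> \<psi>)
      else sat IDS \<Pi> M w (subst \<sigma> \<chi>))"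
  by (auto simp: Disj_def BigDisj_def BigConj_def)

lemma broadcasting_if:
  "broadcasting IDS \<Pi> M w \<sigma> (Conditional [(\<phi>, \<psi>)] \<chi>) \<longleftrightarrow>
     (if sat IDS \<Pi> M w (subst \<sigma> \<phi>) then contains_diamond \<psi> else contains_diamond \<chi>)"
  by (auto simp: hot_condition_def hot_backup_def)

section \<open>A finite universe of pointed models\<close>

text \<open>Sorting by a key may drop elements with equal keys; injectivity of identifiers ensures
  that \<open>neighbours\<close> lists every successor.\<close>

lemma (in linorder) sorted_key_list_of_set_inj_on:
  assumes "inj_on f S" "A \<subseteq> S" "finite A"
  shows "set (sorted_key_list_of_set f A) = A" "length (sorted_key_list_of_set f A) = card A"
proof -
  interpret folding_insort_key "(\<le>)" "(<)" S f
    by unfold_locales (rule assms(1))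
  show "set (sorted_key_list_of_set f A) = A" "length (sorted_key_list_of_set f A) = card A"
    using assms(2,3) by simp_all
qed

lemma set_neighbours:
  assumes "M \<in> model_class IDS \<Pi> \<Delta>" "w \<in> worlds M"
  shows "set (neighbours IDS \<Pi> M w) \<subseteq> worlds M"
    and "length (neighbours IDS \<Pi> M w) \<le> \<Delta>"
proof -
  have fin: "finite (worlds M)" and acc: "accessible M \<subseteq> worlds M \<times> worlds M"
    and inj: "inj_on (ID IDS \<Pi> M) (worlds M)"
    and deg: "card (accessible M `` {w}) \<le> \<Delta>"
    using assms by (auto simp: model_class_def kripke_model_def has_identifiers_def)
  have sub: "accessible M `` {w} \<subseteq> worlds M" using acc by auto
  then have "finite (accessible M `` {w})" using fin finite_subset by blast
  note * = sorted_key_list_of_set_inj_on[OF inj sub this]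
  show "set (neighbours IDS \<Pi> M w) \<subseteq> worlds M"
    unfolding neighbours_def * by (rule sub)
  show "length (neighbours IDS \<Pi> M w) \<le> \<Delta>"
    unfolding neighbours_def * by (rule deg)
qed

text \<open>The identifier can be read off the local input, so the latter can serve as the name of a
  node.\<close>

lemma inj_on_local_input:
  assumes "finite \<Pi>" "M \<in> model_class IDS \<Pi> \<Delta>"
  shows "inj_on (local_input \<Pi> M) (worlds M)"
proof (rule inj_onI)
  fix v w assume vw: "v \<in> worlds M" "w \<in> worlds M" "local_input \<Pi> M v = local_input \<Pi> M w"
  then have "\<forall>p\<in>\<Pi>. v \<in> val M p \<longleftrightarrow> w \<in> val M p"
    using assms(1) by (simp add: local_input_def)
  then have "ID IDS \<Pi> M v = ID IDS \<Pi> M w"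
    using assms(1) by (simp add: ID_def)
  then show "v = w"
    using assms(2) vw by (auto simp: model_class_def has_identifiers_def dest: inj_onD)
qed

text \<open>A pointed model is determined by a bit string and a function assigning to each bit string,
  taken as the name of a node, the list of its neighbours.\<close>

lemma finite_universe:
  fixes IDS \<Pi> :: "'p::linorder set"
  assumes fin: "finite \<Pi>"
  obtains q :: nat and inp :: "nat \<Rightarrow> bool list" and nb :: "nat \<Rightarrow> nat list" where
    "\<And>x. x < q \<Longrightarrow> length (inp x) = card \<Pi>"
    "\<And>x. x < q \<Longrightarrow> length (nb x) \<le> \<Delta>"
    "\<And>x. x < q \<Longrightarrow> set (nb x) \<subseteq> {..<q}"
    "\<And>M :: ('w, 'p) kripke. M \<in> model_class IDS \<Pi> \<Delta> \<Longrightarrow>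
       \<exists>h. \<forall>w\<in>worlds M. h w < q \<and> inp (h w) = local_input \<Pi> M w \<and>
                       nb (h w) = map h (neighbours IDS \<Pi> M w)"
proof -
  define B :: "bool list set" where "B = {bs. length bs = card \<Pi>}"
  define Ls where "Ls = {l. set l \<subseteq> B \<and> length l \<le> \<Delta>}"
  \<comment> \<open>Forcing \<open>[]\<close> outside \<open>B\<close> leaves only finitely many
    functions. As members of \<open>Ls\<close> contain only strings from \<open>B\<close>, replacing
    the point by one of its neighbours stays inside \<open>U\<close>.\<close>
  define U where "U = {N. \<forall>t. (t \<in> B \<longrightarrow> N t \<in> Ls) \<and> (t \<notin> B \<longrightarrow> N t = [])} \<times> B"
  have finB: "finite B"
    unfolding B_def using finite_lists_length_eq[of "UNIV :: bool set" "card \<Pi>"] by simp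
  then have "finite Ls"
    unfolding Ls_def by (rule finite_lists_length_le)
  with finB have "finite U"
    unfolding U_def by (intro finite_cartesian_product finite_set_of_finite_funs)
  then obtain e where e: "bij_betw e {0..<card U} U"
    using ex_bij_betw_nat_finite by blast
  define q where "q = card U"
  define d where "d = inv_into {0..<q} e"
  have d: "d u < q" "e (d u) = u" if "u \<in> U" for u
    using that e bij_betw_inv_into_right[OF e that] bij_betwE[OF bij_betw_inv_into[OF e]]
    unfolding d_def q_def by auto
  have eU: "e x \<in> U" if "x < q" for x
    using that bij_betwE[OF e] unfolding q_def by auto
  define inp where "inp x = snd (e x)" for x
  \<comment> \<open>The neighbours of a pointed model keep its first component; only the point
    moves.\<close>
  define nb where "nb x = map (\<lambda>s. d (fst (e x), s)) (fst (e x) (snd (e x)))" for x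
  have Ls: "fst (e x) (snd (e x)) \<in> Ls" if "x < q" for x
    using eU[OF that] unfolding U_def by (auto simp: mem_Times_iff)
  show thesis
  proof
    fix x assume x: "x < q"
    show "length (inp x) = card \<Pi>"
      using eU[OF x] by (auto simp: inp_def U_def B_def)
    show "length (nb x) \<le> \<Delta>"
      using Ls[OF x] by (simp add: nb_def Ls_def)
    have "(fst (e x), s) \<in> U" if "s \<in> set (fst (e x) (snd (e x)))" for s
      using that eU[OF x] Ls[OF x] unfolding U_def by (auto simp: Ls_def mem_Times_iff)
    then show "set (nb x) \<subseteq> {..<q}"
      unfolding nb_def using d by auto
  next
    fix M :: "('w, 'p) kripke" assume M: "M \<in> model_class IDS \<Pi> \<Delta>"
    define l where "l = local_input \<Pi> M"
    have lB: "l w \<in> B" for w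
      using fin by (simp add: l_def B_def local_input_def)
    have inj: "inj_on l (worlds M)"
      unfolding l_def by (rule inj_on_local_input[OF fin M])
    \<comment> \<open>The neighbour function read off from \<open>M\<close>: a name is decoded to
      its node by inverting \<open>l\<close>, and strings naming no node get
      \<open>[]\<close>.\<close>
    define N where "N t = (if t \<in> l ` worlds M
      then map l (neighbours IDS \<Pi> M (inv_into (worlds M) l t)) else [])" for t
    have N: "N (l w) = map l (neighbours IDS \<Pi> M w)" if "w \<in> worlds M" for w
      using that lB by (simp add: N_def inv_into_f_f[OF inj])
    have "N t \<in> Ls" if "t \<in> B" for t
    proof (cases "t \<in> l ` worlds M")
      case True
      then obtain w where "w \<in> worlds M" "t = l w" by auto
      then show ?thesis
        using N lB set_neighbours[OF M] by (auto simp: Ls_def)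
    next
      case False
      with that show ?thesis by (simp add: N_def Ls_def)
    qed
    moreover have "N t = []" if "t \<notin> B" for t
      using that lB by (auto simp: N_def)
    ultimately have NU: "(N, t) \<in> U" if "t \<in> B" for t
      using that unfolding U_def by auto
    \<comment> \<open>All nodes of \<open>M\<close> share the component \<open>N\<close>, which is
      why \<open>h\<close> commutes with taking neighbours.\<close>
    define h where "h w = d (N, l w)" for w
    have "e (h w) = (N, l w)" "h w < q" for w
      using d NU lB by (auto simp: h_def)
    then have "\<forall>w\<in>worlds M. h w < q \<and> inp (h w) = l w \<and>
                       nb (h w) = map h (neighbours IDS \<Pi> M w)"
      by (auto simp: inp_def nb_def N h_def)
    then show "\<exists>h. \<forall>w\<in>worlds M. h w < q \<and> inp (h w) = local_input \<Pi> M w \<and>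
                       nb (h w) = map h (neighbours IDS \<Pi> M w)"
      unfolding l_def by blast
  qed
qed

section \<open>The simulating program\<close>

text \<open>\<open>Out\<close> displays the circuit state, \<open>Clock\<close> is a ring of bits,
  and \<open>Know x\<close> says that the node still cannot be told apart from \<open>x\<close>.
  \<open>State\<close> and \<open>Gate\<close> carry the communication-free simulation at the
  universe node \<open>x\<close>.\<close>

datatype 'g head = Out nat | Clock nat | Know nat | State nat nat | Gate nat 'g

definition bool_schema :: "bool \<Rightarrow> 'p schema" where
  "bool_schema b = (if b then Top else Neg Top)"

lemma bool_schema_simps [simp]:
  "schema_over \<Pi> X \<Delta> (bool_schema b)"
  "schema_vars (bool_schema b) = {}"
  "schema_dias (bool_schema b) = {}"
  "modal_depth (bool_schema b) = 0"
  "sat IDS \<Pi> M w (bool_schema b) \<longleftrightarrow> b"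
  "subst \<sigma> (bool_schema b) = bool_schema b"
  "schema_size (bool_schema b) \<le> 2"
  by (simp_all add: bool_schema_def)

definition literal :: "'p \<times> bool \<Rightarrow> 'p schema" where
  "literal pb = (if snd pb then Prop (fst pb) else Neg (Prop (fst pb)))"

lemma literal_simps [simp]:
  "schema_over \<Pi> X \<Delta> (literal pb) \<longleftrightarrow> fst pb \<in> \<Pi>"
  "schema_vars (literal pb) = {}"
  "schema_dias (literal pb) = {}"
  "modal_depth (literal pb) = 0"
  "sat IDS \<Pi> M w (literal pb) \<longleftrightarrow> (w \<in> val M (fst pb)) = snd pb"
  "schema_size (literal pb) \<le> 2"
  by (simp_all add: literal_def)

section \<open>Enumeration and ranking of gates\<close>

definition gate_list :: "'g mpc \<Rightarrow> 'g list" where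
  "gate_list C = (SOME gs. distinct gs \<and> set gs = gates C)"

definition gate_preds :: "'g mpc \<Rightarrow> 'g \<Rightarrow> 'g list" where
  "gate_preds C g = filter (\<lambda>h. (h, g) \<in> edges C) (gate_list C)"

text \<open>The number of proper ancestors; it stands in for the depth of a gate, as only strict
  growth along edges and a bound below the circuit size matter.\<close>

definition gate_rank :: "'g mpc \<Rightarrow> 'g \<Rightarrow> nat" where
  "gate_rank C g = card {h. (h, g) \<in> (edges C)\<^sup>+}"

lemma gate_list:
  assumes "is_circuit C"
  shows "distinct (gate_list C)" "set (gate_list C) = gates C"
    "length (gate_list C) = circuit_size C"
proof -
  have "\<exists>gs. distinct gs \<and> set gs = gates C"
    using assms finite_distinct_list[of "gates C"] by (auto simp: is_circuit_def)
  then have *: "distinct (gate_list C) \<and> set (gate_list C) = gates C"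
    unfolding gate_list_def by (rule someI_ex)
  then show "distinct (gate_list C)" "set (gate_list C) = gates C" by auto
  then show "length (gate_list C) = circuit_size C"
    unfolding circuit_size_def by (metis distinct_card)
qed

lemma gate_preds:
  assumes "is_circuit C"
  shows "set (gate_preds C g) = {h. (h, g) \<in> edges C}" "length (gate_preds C g) = fan_in C g"
proof -
  show *: "set (gate_preds C g) = {h. (h, g) \<in> edges C}"
    using assms gate_list[OF assms] by (auto simp: gate_preds_def is_circuit_def)
  have "distinct (gate_preds C g)"
    using gate_list[OF assms] by (simp add: gate_preds_def)
  then show "length (gate_preds C g) = fan_in C g"
    using * by (metis distinct_card fan_in_def)
qed

text \<open>By acyclicity no gate is its own ancestor, so its ancestors miss at least one gate.
  Along an edge from \<open>h\<close> to \<open>g\<close>, the gate \<open>h\<close> itself is a new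
  ancestor.\<close>

lemma gate_rank:
  assumes "is_circuit C"
  shows "g \<in> gates C \<Longrightarrow> gate_rank C g < circuit_size C"
    and "(h, g) \<in> edges C \<Longrightarrow> gate_rank C h < gate_rank C g"
proof -
  have fin: "finite (gates C)" and acyc: "acyclic (edges C)"
    and sub: "edges C \<subseteq> gates C \<times> gates C"
    using assms by (auto simp: is_circuit_def)
  have preds: "{h. (h, g) \<in> (edges C)\<^sup>+} \<subseteq> gates C" for g
    using trancl_subset_Sigma[OF sub] by auto
  show "gate_rank C g < circuit_size C" if "g \<in> gates C"
    unfolding gate_rank_def circuit_size_def
    using that preds acyc by (intro psubset_card_mono fin) (auto simp: acyclic_def)
  show "gate_rank C h < gate_rank C g" if "(h, g) \<in> edges C"
    unfolding gate_rank_def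
  proof (rule psubset_card_mono)
    show "finite {h. (h, g) \<in> (edges C)\<^sup>+}"
      using preds fin finite_subset by blast
    show "{h'. (h', h) \<in> (edges C)\<^sup>+} \<subset> {h. (h, g) \<in> (edges C)\<^sup>+}"
      using that acyc by (auto simp: acyclic_def intro: trancl_into_trancl)
  qed
qed

lemma gate_step_input:
  assumes "is_circuit C" "length bs = length (inputs C)" "g \<in> set (inputs C)"
  shows "gate_step C bs v g = bs ! index (inputs C) g"
proof -
  have "map_of (zip (inputs C) bs) (inputs C ! index (inputs C) g) = Some (bs ! index (inputs C) g)"
    using assms by (intro map_of_zip_nth) (auto simp: is_circuit_def index_less)
  then show ?thesis
    using assms(3) by (simp add: gate_step_def nth_index)
qed

lemma state_length_le_size:
  assumes "is_circuit C"
  shows "state_length C \<le> circuit_size C"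
  unfolding state_length_def circuit_size_def
  using assms by (metis is_circuit_def card_mono distinct_card)

section \<open>Circuit runs on the finite universe and bounded indistinguishability\<close>

locale universe =
  fixes IDS \<Pi> :: "'p::linorder set" and \<Delta> q :: nat
    and inp :: "nat \<Rightarrow> bool list" and nb :: "nat \<Rightarrow> nat list"
  assumes finite_\<Pi>: "finite \<Pi>"
    and degree_pos: "1 \<le> \<Delta>"
    and length_inp: "x < q \<Longrightarrow> length (inp x) = card \<Pi>"
    and length_nb: "x < q \<Longrightarrow> length (nb x) \<le> \<Delta>"
    and set_nb: "x < q \<Longrightarrow> set (nb x) \<subseteq> {..<q}"
begin

text \<open>The recursion of \<open>mpc_state\<close> with \<open>inp\<close> and \<open>nb\<close>
  in place of a model. It depends on the circuit and the universe alone, so its values can be built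
  into the program.\<close>

fun universe_state :: "'g mpc \<Rightarrow> nat \<Rightarrow> nat \<Rightarrow> bool list" where
  "universe_state C 0 x =
     circuit_output C (inp x @ replicate (state_length C * (\<Delta> + 1)) False)"
| "universe_state C (Suc n) x =
     circuit_output C
       (inp x @ universe_state C n x @ concat (map (universe_state C n) (nb x)) @
        replicate (state_length C * (\<Delta> - length (nb x))) False)"

definition universe_input :: "'g mpc \<Rightarrow> nat \<Rightarrow> nat \<Rightarrow> bool list" where
  "universe_input C n x =
     inp x @ universe_state C n x @ concat (map (universe_state C n) (nb x)) @
     replicate (state_length C * (\<Delta> - length (nb x))) False"

lemma length_universe_state [simp]: "length (universe_state C n x) = state_length C"
  by (cases n) (simp_all add: circuit_output_def state_length_def)

lemma universe_state_Suc:
  "j < state_length C \<Longrightarrow>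
   universe_state C (Suc n) x ! j = gate_value C (universe_input C n x) (outputs C ! j)"
  by (simp add: universe_input_def circuit_output_def state_length_def)

text \<open>Bisimilarity up to depth \<open>n\<close>, adapted to ordered neighbour lists of equal
  length.\<close>

fun indist :: "('w, 'p) kripke \<Rightarrow> nat \<Rightarrow> 'w \<Rightarrow> nat \<Rightarrow> bool" where
  "indist M 0 w x \<longleftrightarrow> local_input \<Pi> M w = inp x"
| "indist M (Suc n) w x \<longleftrightarrow>
     local_input \<Pi> M w = inp x \<and> list_all2 (indist M n) (neighbours IDS \<Pi> M w) (nb x)"

text \<open>Needed because a circuit state depends on the node's own previous state as well as on
  those of its neighbours.\<close>

lemma indist_SucD: "indist M (Suc n) w x \<Longrightarrow> indist M n w x"
  by (induction n arbitrary: w x) (auto elim: list_all2_mono)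

text \<open>After \<open>n\<close> rounds a state has been influenced only by the local inputs
  within distance \<open>n\<close>, which \<open>indist\<close> compares.\<close>

lemma mpc_state_indist:
  "indist M n w x \<Longrightarrow> mpc_state IDS \<Pi> \<Delta> C M n w = universe_state C n x"
proof (induction n arbitrary: w x)
  case 0
  then show ?case by simp
next
  case (Suc n)
  have "map (mpc_state IDS \<Pi> \<Delta> C M n) (neighbours IDS \<Pi> M w) = map (universe_state C n) (nb x)"
    using Suc by (auto simp: list_eq_iff_nth_eq list_all2_conv_all_nth)
  moreover have "length (neighbours IDS \<Pi> M w) = length (nb x)"
    using Suc.prems by (auto simp: list_all2_lengthD)
  moreover have "mpc_state IDS \<Pi> \<Delta> C M n w = universe_state C n x"
    by (rule Suc.IH[OF indist_SucD[OF Suc.prems]])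
  moreover have "local_input \<Pi> M w = inp x"
    using Suc.prems by simp
  ultimately show ?case
    by (simp only: mpc_state.simps universe_state.simps)
qed

section \<open>Heads and clauses of the simulator\<close>

definition heads :: "'g mpc \<Rightarrow> 'g head list" where
  "heads C =
     map Out [0..<state_length C] @ map Clock [0..<Suc (circuit_size C)] @ map Know [0..<q] @
     map (\<lambda>(x, j). State x j) (List.product [0..<q] [0..<state_length C]) @
     map (\<lambda>(x, g). Gate x g) (List.product [0..<q] (gate_list C))"

definition head_var :: "'g mpc \<Rightarrow> 'g head \<Rightarrow> 'p schema" where
  "head_var C h = SVar (index (heads C) h)"

definition tick :: "'g mpc \<Rightarrow> 'p schema" where
  "tick C = head_var C (Clock (circuit_size C))"

definition local_schema :: "nat \<Rightarrow> 'p schema" where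
  "local_schema x = BigConj (map literal (zip (sorted_list_of_set \<Pi>) (inp x)))"

text \<open>List positions start at 0 and diamonds at 1, hence \<open>Suc i\<close>. The negative
  case excludes a neighbour that \<open>x\<close> lacks.\<close>

definition neighbour_schema :: "'g mpc \<Rightarrow> nat \<Rightarrow> nat \<Rightarrow> 'p schema" where
  "neighbour_schema C x i =
     (if i < length (nb x) then Dia (Suc i) (head_var C (Know (nb x ! i))) else Neg (Dia (Suc i) Top))"

definition know_schema :: "'g mpc \<Rightarrow> nat \<Rightarrow> 'p schema" where
  "know_schema C x = Conj (local_schema x) (BigConj (map (neighbour_schema C x) [0..<\<Delta>]))"

text \<open>Mirrors the layout of \<open>universe_input\<close>: hard-wired local input, then one
  block per member of \<open>x # nb x\<close>, then zero padding.\<close>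

definition input_schema :: "'g mpc \<Rightarrow> nat \<Rightarrow> nat \<Rightarrow> 'p schema" where
  "input_schema C x i =
     (if i < card \<Pi> then bool_schema (inp x ! i)
      else let b = (i - card \<Pi>) div state_length C; j = (i - card \<Pi>) mod state_length C in
        if b < length (x # nb x) then head_var C (State ((x # nb x) ! b) j) else bool_schema False)"

definition gate_schema :: "'g mpc \<Rightarrow> nat \<Rightarrow> 'g \<Rightarrow> 'p schema" where
  "gate_schema C x g =
     (if g \<in> set (inputs C) then input_schema C x (index (inputs C) g)
      else case label C g of
        AndGate \<Rightarrow> BigConj (map (\<lambda>h. head_var C (Gate x h)) (gate_preds C g))
      | OrGate \<Rightarrow> BigDisj (map (\<lambda>h. head_var C (Gate x h)) (gate_preds C g))
      | NotGate \<Rightarrow> BigDisj (map (\<lambda>h. Neg (head_var C (Gate x h))) (gate_preds C g)))"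

text \<open>The terminal clauses of \<open>Out\<close> and \<open>State\<close> have round 0 of the circuit hard-wired.\<close>

fun head_terminal :: "'g mpc \<Rightarrow> 'g head \<Rightarrow> 'p schema" where
  "head_terminal C (Out j) =
     BigDisj (map (\<lambda>x. Conj (local_schema x) (bool_schema (universe_state C 0 x ! j))) [0..<q])"
| "head_terminal C (Clock i) = bool_schema (i = 0)"
| "head_terminal C (Know x) = local_schema x"
| "head_terminal C (State x j) = bool_schema (universe_state C 0 x ! j)"
| "head_terminal C (Gate x g) = Top"

text \<open>Between ticks \<open>Out\<close> takes the arbitrary value \<open>Top\<close>, since
  those rounds are not appointed. \<open>Gate\<close> heads are never reset: stale values are
  overwritten in order of rank after each tick.\<close>

fun head_iteration :: "'g mpc \<Rightarrow> 'g head \<Rightarrow> 'p iteration_clause" where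
  "head_iteration C (Out j) =
     Conditional
       [(tick C, BigDisj (map (\<lambda>x. Conj (know_schema C x) (head_var C (Gate x (outputs C ! j)))) [0..<q]))]
       Top"
| "head_iteration C (Clock i) =
     Standard (head_var C (Clock (if i = 0 then circuit_size C else i - 1)))"
| "head_iteration C (Know x) = Conditional [(tick C, know_schema C x)] (head_var C (Know x))"
| "head_iteration C (State x j) =
     Conditional [(tick C, head_var C (Gate x (outputs C ! j)))] (head_var C (State x j))"
| "head_iteration C (Gate x g) = Standard (gate_schema C x g)"

text \<open>The \<open>Out\<close> heads come first in \<open>heads\<close>, so bit positions of the
  circuit and of the program agree and both position sets carry over unchanged.\<close>

definition simulator :: "'g mpc \<Rightarrow> 'p program" where
  "simulator C =
     \<lparr>clauses = map (\<lambda>h. (head_terminal C h, head_iteration C h)) (heads C),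
      attention_heads = attention_bits C, print_heads = print_bits C\<rparr>"

lemma num_heads_simulator: "num_heads (simulator C) = length (heads C)"
  by (simp add: num_heads_def simulator_def)

lemma terminal_body_simulator:
  "i < length (heads C) \<Longrightarrow> terminal_body (simulator C) i = head_terminal C (heads C ! i)"
  by (simp add: terminal_body_def simulator_def)

lemma iteration_clause_simulator:
  "i < length (heads C) \<Longrightarrow> iteration_clause (simulator C) i = head_iteration C (heads C ! i)"
  by (simp add: iteration_clause_def simulator_def)

section \<open>Semantics of the auxiliary schemata\<close>

lemma sat_local_schema:
  assumes "x < q"
  shows "sat IDS \<Pi> M w (local_schema x) \<longleftrightarrow> local_input \<Pi> M w = inp x"
proof -
  have *: "(\<forall>\<phi>\<in>set (map literal (zip ps bs)). sat IDS \<Pi> M w \<phi>) \<longleftrightarrow>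
      map (\<lambda>p. w \<in> val M p) ps = bs" if "length ps = length bs" for ps bs
    using that by (induction ps bs rule: list_induct2) auto
  show ?thesis
    unfolding local_schema_def local_input_def sat_BigConj
    using length_inp[OF assms] finite_\<Pi> by (intro *) simp
qed

lemma subst_local_schema [simp]: "subst \<sigma> (local_schema x) = local_schema x"
  by (rule subst_closed) (simp add: local_schema_def)

definition head_sat :: "'g mpc \<Rightarrow> ('w, 'p) kripke \<Rightarrow> nat \<Rightarrow> 'w \<Rightarrow> 'g head \<Rightarrow> bool" where
  "head_sat C M t w h =
     sat IDS \<Pi> M w (head_formula (simulator C) t (index (heads C) h))"

lemma head_sat_0:
  assumes "h \<in> set (heads C)"
  shows "head_sat C M 0 w h \<longleftrightarrow> sat IDS \<Pi> M w (head_terminal C h)"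
  using assms by (simp add: head_sat_def terminal_body_simulator index_less nth_index)

lemma head_sat_Suc:
  assumes "h \<in> set (heads C)"
  shows "head_sat C M (Suc t) w h \<longleftrightarrow>
    sat IDS \<Pi> M w (clause_formula (head_formula (simulator C) t) (head_iteration C h))"
  using assms by (simp add: head_sat_def iteration_clause_simulator index_less nth_index)

lemma sat_head_var [simp]:
  "sat IDS \<Pi> M w (subst (head_formula (simulator C) t) (head_var C h)) \<longleftrightarrow> head_sat C M t w h"
  by (simp add: head_var_def head_sat_def)

lemma set_heads:
  "Out j \<in> set (heads C) \<longleftrightarrow> j < state_length C"
  "Clock i \<in> set (heads C) \<longleftrightarrow> i \<le> circuit_size C"
  "Know x \<in> set (heads C) \<longleftrightarrow> x < q"
  "State x j \<in> set (heads C) \<longleftrightarrow> x < q \<and> j < state_length C"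
  "Gate x g \<in> set (heads C) \<longleftrightarrow> x < q \<and> g \<in> set (gate_list C)"
  by (auto simp: heads_def)

text \<open>A single true bit travels around the ring, one place per round.\<close>

lemma head_sat_Clock:
  "i \<le> circuit_size C \<Longrightarrow> head_sat C M t w (Clock i) \<longleftrightarrow> t mod Suc (circuit_size C) = i"
proof (induction t arbitrary: i)
  case 0
  then show ?case by (auto simp: head_sat_0 set_heads)
next
  case (Suc t)
  then show ?case
    by (auto simp: head_sat_Suc set_heads div_mod_Suc(2))
qed

lemma sat_tick:
  "sat IDS \<Pi> M w (subst (head_formula (simulator C) t) (tick C)) \<longleftrightarrow>
     t mod Suc (circuit_size C) = circuit_size C"
  by (simp add: tick_def head_sat_Clock)

text \<open>One exchange of \<open>Know\<close> bits refines depth \<open>n\<close> to depth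
  \<open>Suc n\<close>, because the diamonds fix both the number of neighbours and the class of
  each.\<close>

lemma sat_know_schema:
  assumes M: "M \<in> model_class IDS \<Pi> \<Delta>" and w: "w \<in> worlds M" and x: "x < q"
    and know: "\<And>v y. v \<in> worlds M \<Longrightarrow> y < q \<Longrightarrow> head_sat C M t v (Know y) \<longleftrightarrow> indist M n v y"
  shows "sat IDS \<Pi> M w (subst (head_formula (simulator C) t) (know_schema C x)) \<longleftrightarrow>
    indist M (Suc n) w x"
proof -
  define ns where "ns = neighbours IDS \<Pi> M w"
  have ns: "set ns \<subseteq> worlds M" "length ns \<le> \<Delta>"
    using set_neighbours[OF M w] by (simp_all add: ns_def)
  have "ns ! i \<in> worlds M" if "i < length ns" for i
    using that ns(1) nth_mem by blast
  moreover have "nb x ! i < q" if "i < length (nb x)" for i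
    using that set_nb[OF x] nth_mem by blast
  ultimately have "sat IDS \<Pi> M w (subst (head_formula (simulator C) t) (neighbour_schema C x i)) \<longleftrightarrow>
      (if i < length (nb x) then i < length ns \<and> indist M n (ns ! i) (nb x ! i)
       else \<not> i < length ns)" for i
    using know by (auto simp: neighbour_schema_def ns_def[symmetric])
  then have "sat IDS \<Pi> M w (subst (head_formula (simulator C) t) (know_schema C x)) \<longleftrightarrow>
      local_input \<Pi> M w = inp x \<and>
      (\<forall>i<\<Delta>. if i < length (nb x) then i < length ns \<and> indist M n (ns ! i) (nb x ! i)
       else \<not> i < length ns)"
    by (auto simp: know_schema_def sat_local_schema[OF x] atLeast0LessThan)
  also have "\<dots> \<longleftrightarrow> local_input \<Pi> M w = inp x \<and> list_all2 (indist M n) ns (nb x)"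
  proof -
    have "list_all2 (indist M n) ns (nb x)"
      if *: "\<forall>i<\<Delta>. if i < length (nb x) then i < length ns \<and> indist M n (ns ! i) (nb x ! i)
       else \<not> i < length ns"
      unfolding list_all2_conv_all_nth
    proof (intro conjI allI impI)
      \<comment> \<open>If the lengths differed, the smaller one would be a position below \<Delta>
        at which the condition fails.\<close>
      show len: "length ns = length (nb x)"
        using * ns(2) length_nb[OF x]
        by (metis linorder_neqE_nat order_less_le_trans less_irrefl)
      fix i assume "i < length ns"
      with len ns(2) have "i < \<Delta>" "i < length (nb x)" by simp_all
      with * show "indist M n (ns ! i) (nb x ! i)" by simp
    qed
    then show ?thesis
      by (auto simp: list_all2_conv_all_nth)
  qed
  finally show ?thesis by (simp add: ns_def)
qed

section \<open>Correctness of the simulation\<close>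

context
  fixes C :: "'g mpc"
  assumes mpc: "is_mpc \<Pi> \<Delta> C"
begin

lemma circuit: "is_circuit C" and length_inputs: "length (inputs C) = card \<Pi> + state_length C * (\<Delta> + 1)"
  using mpc by (simp_all add: is_mpc_def)

lemma length_universe_input:
  assumes "x < q"
  shows "length (universe_input C n x) = length (inputs C)"
proof -
  have "length (concat (map (universe_state C n) ys)) = state_length C * length ys" for ys
    by (induction ys) auto
  then show ?thesis
    using length_nb[OF assms] length_inp[OF assms] unfolding length_inputs
    by (simp add: universe_input_def flip: distrib_left)
qed

text \<open>Locates the position in the local input, in a state block, or in the padding.\<close>

lemma sat_input_schema:
  assumes x: "x < q" and i: "i < length (inputs C)"
    and state: "\<And>y j. y < q \<Longrightarrow> j < state_length C \<Longrightarrow>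
      head_sat C M t w (State y j) \<longleftrightarrow> universe_state C n y ! j"
  shows "sat IDS \<Pi> M w (subst (head_formula (simulator C) t) (input_schema C x i)) \<longleftrightarrow>
    universe_input C n x ! i"
proof (cases "i < card \<Pi>")
  case True
  then show ?thesis
    using length_inp[OF x] by (simp add: input_schema_def universe_input_def nth_append)
next
  case False
  define k r xs where "k = state_length C" and "r = i - card \<Pi>" and "xs = x # nb x"
  have r: "r < k * (\<Delta> + 1)" and k: "k > 0"
    using i False unfolding length_inputs r_def k_def by (auto intro: Nat.gr0I)
  have len: "length (concat (map (universe_state C n) ys)) = k * length ys" for ys
    by (induction ys) (auto simp: k_def)
  have "universe_input C n x ! i =
      (concat (map (universe_state C n) xs) @ replicate (k * (\<Delta> - length (nb x))) False) ! r"
    using False length_inp[OF x] by (simp add: universe_input_def xs_def k_def r_def nth_append)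
  \<comment> \<open>A block number beyond \<open>xs\<close> lands in the padding, where the bit is
    \<open>False\<close>; the conjunction covers both cases.\<close>
  also have "\<dots> = (r div k < length xs \<and> universe_state C n (xs ! (r div k)) ! (r mod k))"
  proof (cases "r < k * length xs")
    case True
    then have "r div k < length xs" using k by (simp add: div_less_iff_less_mult mult.commute)
    moreover have "concat (map (universe_state C n) xs) ! r =
        map (universe_state C n) xs ! (r div k) ! (r mod k)"
      by (rule nth_concat_uniform) (use True in \<open>auto simp: k_def\<close>)
    ultimately show ?thesis
      using True by (simp add: nth_append len)
  next
    case False
    then have "\<not> r div k < length xs" using k by (simp add: div_less_iff_less_mult mult.commute)
    moreover have "r - k * length xs < k * (\<Delta> - length (nb x))"
      using r False length_nb[OF x] by (simp add: xs_def diff_mult_distrib2)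
    ultimately show ?thesis
      using False by (simp add: nth_append len)
  qed
  also have "\<dots> \<longleftrightarrow> (r div k < length xs \<and> head_sat C M t w (State (xs ! (r div k)) (r mod k)))"
  proof -
    have "set xs \<subseteq> {..<q}" using x set_nb[OF x] by (simp add: xs_def)
    moreover have "r mod k < k" using k by simp
    ultimately show ?thesis
      using state[of "xs ! (r div k)" "r mod k"] by (auto simp: k_def dest: nth_mem)
  qed
  finally show ?thesis
    using False by (simp add: input_schema_def Let_def xs_def k_def r_def)
qed

text \<open>A single evaluation step: only the direct predecessors need to be correct beforehand, so
  correctness spreads by one rank per round.\<close>

lemma sat_gate_schema:
  assumes x: "x < q"
    and state: "\<And>y j. y < q \<Longrightarrow> j < state_length C \<Longrightarrow>
      head_sat C M t w (State y j) \<longleftrightarrow> universe_state C n y ! j"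
    and preds: "\<And>h. (h, g) \<in> edges C \<Longrightarrow>
      head_sat C M t w (Gate x h) \<longleftrightarrow> gate_value C (universe_input C n x) h"
  shows "sat IDS \<Pi> M w (subst (head_formula (simulator C) t) (gate_schema C x g)) \<longleftrightarrow>
    gate_value C (universe_input C n x) g"
proof (cases "g \<in> set (inputs C)")
  case True
  show ?thesis
    unfolding gate_value_unfold[OF circuit, of _ g]
      gate_step_input[OF circuit length_universe_input[OF x] True]
    using True sat_input_schema[OF x index_less[OF True] state]
    by (simp add: gate_schema_def)
next
  case False
  then show ?thesis
    unfolding gate_value_unfold[OF circuit, of _ g]
    using preds
    by (auto simp: gate_schema_def gate_step_def gate_preds[OF circuit] split: gate_label.split)
qed

lemma outputs_gate: "j < state_length C \<Longrightarrow> outputs C ! j \<in> gates C"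
  using circuit by (auto simp: is_circuit_def state_length_def)

text \<open>A gate of rank \<open>r\<close> has settled once the clock exceeds \<open>r\<close>; as the ranks are smaller than
  the number of gates, all gates have settled when the clock ticks.\<close>

lemma simulation_invariant:
  fixes M :: "('w, 'p) kripke"
  defines "L \<equiv> Suc (circuit_size C)"
  assumes M: "M \<in> model_class IDS \<Pi> \<Delta>" and w: "w \<in> worlds M" and x: "x < q"
  shows "head_sat C M t w (Know x) \<longleftrightarrow> indist M (t div L) w x"
    and "j < state_length C \<Longrightarrow> head_sat C M t w (State x j) \<longleftrightarrow> universe_state C (t div L) x ! j"
    and "g \<in> gates C \<Longrightarrow> gate_rank C g < t mod L \<Longrightarrow>
      head_sat C M t w (Gate x g) \<longleftrightarrow> gate_value C (universe_input C (t div L) x) g"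
proof -
  \<comment> \<open>The three claims are bundled and quantified over all nodes, since
    \<open>Know\<close> is updated from the neighbours, while \<open>State\<close> and
    \<open>Gate\<close> depend on each other.\<close>
  define inv where "inv t \<longleftrightarrow> (\<forall>w\<in>worlds M. \<forall>x<q.
      (head_sat C M t w (Know x) \<longleftrightarrow> indist M (t div L) w x) \<and>
      (\<forall>j<state_length C. head_sat C M t w (State x j) \<longleftrightarrow> universe_state C (t div L) x ! j) \<and>
      (\<forall>g\<in>gates C. gate_rank C g < t mod L \<longrightarrow>
         head_sat C M t w (Gate x g) \<longleftrightarrow> gate_value C (universe_input C (t div L) x) g))" for t
  have "inv t" for t
  proof (induction t)
    case 0
    then show ?case
      by (simp add: inv_def head_sat_0 set_heads sat_local_schema)
  next
    case (Suc t)
    have tick: "sat IDS \<Pi> M w (subst (head_formula (simulator C) t) (tick C)) \<longleftrightarrow>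
        t mod L = circuit_size C" for w
      by (simp add: sat_tick L_def)
    show ?case
      unfolding inv_def
    proof (intro ballI allI impI conjI)
      fix w x assume w: "w \<in> worlds M" and x: "x < q"
      show "head_sat C M (Suc t) w (Know x) \<longleftrightarrow> indist M (Suc t div L) w x"
      proof -
        have "sat IDS \<Pi> M w (subst (head_formula (simulator C) t) (know_schema C x)) \<longleftrightarrow>
            indist M (Suc (t div L)) w x"
          using Suc by (intro sat_know_schema[OF M w x]) (auto simp: inv_def)
        moreover have "head_sat C M t w (Know x) \<longleftrightarrow> indist M (t div L) w x"
          using Suc w x by (auto simp: inv_def)
        ultimately show ?thesis
          using x by (simp add: head_sat_Suc set_heads sat_clause_formula_if tick div_mod_Suc(1) L_def
              del: clause_formula.simps indist.simps)
      qed
      show "head_sat C M (Suc t) w (State x j) \<longleftrightarrow> universe_state C (Suc t div L) x ! j"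
        if j: "j < state_length C" for j
      proof -
        \<comment> \<open>At a tick the clock reading exceeds every rank, so the output gates
          already hold the next state.\<close>
        have "head_sat C M t w (Gate x (outputs C ! j)) \<longleftrightarrow>
            universe_state C (Suc (t div L)) x ! j" if "t mod L = circuit_size C"
          using that Suc w x outputs_gate[OF j] gate_rank(1)[OF circuit outputs_gate[OF j]]
          unfolding universe_state_Suc[OF j] by (auto simp: inv_def)
        moreover have "head_sat C M t w (State x j) \<longleftrightarrow> universe_state C (t div L) x ! j"
          using Suc w x j by (auto simp: inv_def)
        ultimately show ?thesis
          using x j by (simp add: head_sat_Suc set_heads sat_clause_formula_if tick div_mod_Suc(1) L_def
              del: clause_formula.simps universe_state.simps)
      qed
      show "head_sat C M (Suc t) w (Gate x g) \<longleftrightarrow>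
          gate_value C (universe_input C (Suc t div L) x) g"
        if g: "g \<in> gates C" and rank: "gate_rank C g < Suc t mod L" for g
      proof -
        \<comment> \<open>Otherwise the clock would wrap to 0, and no rank lies below 0.\<close>
        have "t mod L \<noteq> L - 1"
          using rank div_mod_Suc(2)[of L t] by (auto simp: L_def)
        then have mod: "Suc t mod L = Suc (t mod L)" and div: "Suc t div L = t div L"
          using div_mod_Suc[of L t] by (simp_all add: L_def)
        \<comment> \<open>Predecessors have smaller rank, hence settled at least one round
          earlier.\<close>
        have "h \<in> gates C" "gate_rank C h < t mod L" if "(h, g) \<in> edges C" for h
          using that circuit gate_rank(2)[OF circuit that] rank mod by (auto simp: is_circuit_def)
        then have "sat IDS \<Pi> M w (subst (head_formula (simulator C) t) (gate_schema C x g)) \<longleftrightarrow>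
            gate_value C (universe_input C (t div L) x) g"
          using x Suc w by (intro sat_gate_schema) (auto simp: inv_def)
        then show ?thesis
          using x g div by (simp add: head_sat_Suc set_heads gate_list[OF circuit])
      qed
    qed
  qed
  then show "head_sat C M t w (Know x) \<longleftrightarrow> indist M (t div L) w x"
    and "j < state_length C \<Longrightarrow> head_sat C M t w (State x j) \<longleftrightarrow> universe_state C (t div L) x ! j"
    and "g \<in> gates C \<Longrightarrow> gate_rank C g < t mod L \<Longrightarrow>
      head_sat C M t w (Gate x g) \<longleftrightarrow> gate_value C (universe_input C (t div L) x) g"
    using w x by (auto simp: inv_def)
qed

text \<open>The node \<open>z\<close> makes some disjunct match at \<open>w\<close>. Other matching
  nodes do no harm: all of them agree with the state of \<open>w\<close> in round \<open>n\<close>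
  by \<open>mpc_state_indist\<close>.\<close>

lemma head_sat_Out:
  fixes M :: "('w, 'p) kripke"
  assumes M: "M \<in> model_class IDS \<Pi> \<Delta>" and w: "w \<in> worlds M"
    and z: "z < q" "\<And>n. indist M n w z"
    and j: "j < state_length C"
  shows "head_sat C M (n * Suc (circuit_size C)) w (Out j) \<longleftrightarrow> mpc_state IDS \<Pi> \<Delta> C M n w ! j"
proof -
  have eq: "(\<exists>x<q. indist M n w x \<and> universe_state C n x ! j) \<longleftrightarrow> mpc_state IDS \<Pi> \<Delta> C M n w ! j"
    using z by (metis mpc_state_indist)
  show ?thesis
  proof (cases n)
    case 0
    then show ?thesis
      using j eq by (auto simp: head_sat_0 set_heads sat_local_schema)
  next
    case (Suc n')
    define L where "L = Suc (circuit_size C)"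
    \<comment> \<open>The round just before the display: the clock ticks, \<open>Know\<close> has
      depth \<open>n'\<close>, and the gates hold the state of round \<open>Suc n'\<close>.\<close>
    define t where "t = n' * L + circuit_size C"
    have "circuit_size C < L" by (simp add: L_def)
    then have t: "n * L = Suc t" "t div L = n'" "t mod L = circuit_size C"
      by (simp_all add: t_def Suc) (simp add: L_def)
    have "sat IDS \<Pi> M w (subst (head_formula (simulator C) t) (know_schema C x)) \<longleftrightarrow> indist M n w x"
      if x: "x < q" for x
      unfolding Suc
      using simulation_invariant(1)[OF M, of _ _ t] t(2)
      by (intro sat_know_schema[OF M w x]) (simp add: L_def)
    moreover have "head_sat C M t w (Gate x (outputs C ! j)) \<longleftrightarrow> universe_state C n x ! j"
      if x: "x < q" for x
      unfolding Suc universe_state_Suc[OF j]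
      using simulation_invariant(3)[OF M w x outputs_gate[OF j], of t] t(2,3)
        gate_rank(1)[OF circuit outputs_gate[OF j]] by (simp add: L_def)
    ultimately show ?thesis
      using eq j t unfolding L_def[symmetric]
      by (auto simp: head_sat_Suc set_heads sat_clause_formula_if sat_tick L_def
          simp del: clause_formula.simps)
  qed
qed

lemma length_mpc_state: "length (mpc_state IDS \<Pi> \<Delta> C M n w) = state_length C"
  by (cases n) (simp_all add: circuit_output_def state_length_def)

lemma program_appointed_simulator:
  fixes M :: "('w, 'p) kripke"
  assumes M: "M \<in> model_class IDS \<Pi> \<Delta>" and w: "w \<in> worlds M"
    and z: "z < q" "\<And>n. indist M n w z"
  shows "program_appointed IDS \<Pi> (simulator C) M w (n * Suc (circuit_size C)) =
    mpc_appointed IDS \<Pi> \<Delta> C M w n"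
proof -
  define t where "t = n * Suc (circuit_size C)"
  define I where "I = attention_bits C \<union> print_bits C"
  define k where "k = state_length C"
  have I: "I \<subseteq> {..<k}"
    using mpc by (auto simp: I_def k_def is_mpc_def)
  have k: "k \<le> length (heads C)"
    by (simp add: heads_def k_def)
  \<comment> \<open>All appointed positions lie below \<open>k\<close>, so the auxiliary heads
    cannot contribute.\<close>
  have nths: "nths xs I = nths (take k xs) I" for xs :: "bool list"
  proof -
    have "nths xs I = nths (take k xs @ drop k xs) I" by simp
    also have "\<dots> = nths (take k xs) I @ nths (drop k xs) {j. j + length (take k xs) \<in> I}"
      by (rule nths_append)
    also have "nths (drop k xs) {j. j + length (take k xs) \<in> I} = []"
    proof (cases "k \<le> length xs")
      case True
      then have "{j. j + length (take k xs) \<in> I} = {}" using I by auto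
      then show ?thesis by simp
    qed simp
    finally show ?thesis by simp
  qed
  have "take k (configuration IDS \<Pi> (simulator C) M t w) = mpc_state IDS \<Pi> \<Delta> C M n w"
  proof (rule nth_equalityI)
    show "length (take k (configuration IDS \<Pi> (simulator C) M t w)) =
        length (mpc_state IDS \<Pi> \<Delta> C M n w)"
      using k by (simp add: configuration_def num_heads_simulator length_mpc_state k_def)
  next
    fix j assume "j < length (take k (configuration IDS \<Pi> (simulator C) M t w))"
    then have j: "j < k" by simp
    then have Out: "heads C ! j = Out j" and mem: "Out j \<in> set (heads C)"
      by (simp_all add: set_heads k_def) (simp add: heads_def nth_append)
    \<comment> \<open>A head formula depends on its number only through the head listed there, so
      distinctness of \<open>heads\<close> need not be shown.\<close>
    have "head_formula (simulator C) t j = head_formula (simulator C) t (index (heads C) (Out j))"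
      using j k Out nth_index[OF mem] index_less[OF mem]
      by (cases t) (simp_all add: terminal_body_simulator iteration_clause_simulator)
    then show "take k (configuration IDS \<Pi> (simulator C) M t w) ! j =
        mpc_state IDS \<Pi> \<Delta> C M n w ! j"
      using j k head_sat_Out[OF M w z, of j n]
      by (simp add: configuration_def num_heads_simulator head_sat_def t_def k_def)
  qed
  moreover have "take k (mpc_state IDS \<Pi> \<Delta> C M n w) = mpc_state IDS \<Pi> \<Delta> C M n w"
    by (simp add: length_mpc_state k_def)
  ultimately have "nths (configuration IDS \<Pi> (simulator C) M t w) I =
      nths (mpc_state IDS \<Pi> \<Delta> C M n w) I"
    using nths by metis
  moreover have "attention_heads (simulator C) \<union> print_heads (simulator C) = I"
    by (simp add: simulator_def I_def)
  ultimately show ?thesis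
    by (simp add: program_appointed_def mpc_appointed_def t_def I_def)
qed

end

section \<open>Communication rounds\<close>

lemma schema_dias_head_var [simp]: "schema_dias (head_var C h) = {}"
  by (simp add: head_var_def)

lemma schema_dias_local_schema [simp]: "schema_dias (local_schema x) = {}"
  by (auto simp: local_schema_def)

lemma schema_dias_input_schema [simp]: "schema_dias (input_schema C x i) = {}"
  by (simp add: input_schema_def Let_def)

lemma schema_dias_gate_schema [simp]: "schema_dias (gate_schema C x g) = {}"
  by (auto simp: gate_schema_def split: gate_label.split)

text \<open>Position 0 exists because \<Delta> is positive, and both branches of
  \<open>neighbour_schema\<close> contain a diamond.\<close>

lemma contains_diamond_know_schema: "contains_diamond (know_schema C x)"
  using degree_pos by (force simp: contains_diamond_def know_schema_def neighbour_schema_def)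

text \<open>Diamonds enter only through \<open>know_schema\<close>, which occurs solely in
  consequences guarded by \<open>tick\<close>.\<close>

lemma broadcasting_imp_tick:
  assumes "broadcasting IDS \<Pi> M w (head_formula (simulator C) t) (head_iteration C h)"
  shows "t mod Suc (circuit_size C) = circuit_size C"
  using assms
  by (cases h) (simp_all add: broadcasting_if sat_tick contains_diamond_def
      del: broadcasting.simps(2) split: if_splits)

lemma global_rounds_simulator:
  assumes "0 < q" "worlds M \<noteq> {}"
  shows "{0} \<union> global_rounds IDS \<Pi> (simulator C) M = range (\<lambda>n. n * Suc (circuit_size C))"
proof -
  define L where "L = Suc (circuit_size C)"
  have *: "(\<exists>w\<in>worlds M. \<exists>i<num_heads (simulator C).
      communication_clause (iteration_clause (simulator C) i) \<and>
      broadcasting IDS \<Pi> M w (head_formula (simulator C) t) (iteration_clause (simulator C) i)) \<longleftrightarrow>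
      t mod L = circuit_size C" (is "?B \<longleftrightarrow> _") for t
  proof
    assume ?B
    then show "t mod L = circuit_size C"
      by (auto simp: num_heads_simulator iteration_clause_simulator L_def
          dest: broadcasting_imp_tick)
  next
    assume t: "t mod L = circuit_size C"
    obtain w where w: "w \<in> worlds M" using assms(2) by auto
    \<comment> \<open>One head that broadcasts at every tick suffices; nonemptiness of the universe
      provides it.\<close>
    have mem: "Know 0 \<in> set (heads C)" using assms(1) by (simp add: set_heads)
    have "communication_clause (head_iteration C (Know 0))"
      by (simp add: contains_diamond_know_schema)
    moreover have "broadcasting IDS \<Pi> M w (head_formula (simulator C) t) (head_iteration C (Know 0))"
      using t by (simp add: broadcasting_if sat_tick contains_diamond_know_schema L_def
          del: broadcasting.simps)
    ultimately show ?B
      using w index_less[OF mem] nth_index[OF mem]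
      by (metis iteration_clause_simulator num_heads_simulator)
  qed
  have "t \<in> {0} \<union> global_rounds IDS \<Pi> (simulator C) M \<longleftrightarrow> L dvd t" for t
  proof (cases t)
    case 0
    then show ?thesis by simp
  next
    case (Suc t')
    \<comment> \<open>Broadcasting in a round is decided by the clock of the preceding round, hence
      the shift by one.\<close>
    have "L dvd Suc t' \<longleftrightarrow> t' mod L = circuit_size C"
      using div_mod_Suc(2)[of L t'] by (auto simp: L_def dvd_eq_mod_eq_0)
    then show ?thesis
      using *[of t'] by (simp add: global_rounds_def Suc)
  qed
  then show ?thesis
    by (auto simp: L_def[symmetric] dvd_def mult.commute)
qed

lemma communication_equivalent_simulator:
  assumes mpc: "is_mpc \<Pi> \<Delta> C"
    and universal: "\<And>M :: (nat, 'p) kripke. M \<in> model_class IDS \<Pi> \<Delta> \<Longrightarrow>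
       \<exists>h. \<forall>w\<in>worlds M. h w < q \<and> inp (h w) = local_input \<Pi> M w \<and>
                       nb (h w) = map h (neighbours IDS \<Pi> M w)"
  shows "communication_equivalent IDS \<Pi> \<Delta> (simulator C) C"
  unfolding communication_equivalent_def Let_def
proof (intro allI impI ballI)
  fix M :: "(nat, 'p) kripke" and w
  assume M: "M \<in> model_class IDS \<Pi> \<Delta>" and w: "w \<in> worlds M"
  obtain h where h: "\<And>w. w \<in> worlds M \<Longrightarrow> h w < q"
    "\<And>w. w \<in> worlds M \<Longrightarrow> inp (h w) = local_input \<Pi> M w"
    "\<And>w. w \<in> worlds M \<Longrightarrow> nb (h w) = map h (neighbours IDS \<Pi> M w)"
    using universal[OF M] by blast
  \<comment> \<open>As \<open>h\<close> preserves local inputs and neighbour lists,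
    \<open>h w\<close> remains indistinguishable from \<open>w\<close> at every depth.\<close>
  have indist: "w \<in> worlds M \<Longrightarrow> indist M n w (h w)" for w n
  proof (induction n arbitrary: w)
    case 0
    then show ?case by (simp add: h)
  next
    case (Suc n)
    then show ?case
      using set_neighbours(1)[OF M Suc.prems]
      by (auto simp: h list_all2_map2 list_all2_same)
  qed
  have mono: "strict_mono (\<lambda>n. n * Suc (circuit_size C))"
    by (rule strict_monoI) (rule mult_less_mono1, simp_all)
  have "0 < q" "worlds M \<noteq> {}" using h(1)[OF w] w by auto
  then have rounds: "{0} \<union> global_rounds IDS \<Pi> (simulator C) M = range (\<lambda>n. n * Suc (circuit_size C))"
    by (rule global_rounds_simulator)
  show "infinite ({0} \<union> global_rounds IDS \<Pi> (simulator C) M) \<and>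
    (\<forall>n. mpc_appointed IDS \<Pi> \<Delta> C M w n =
      program_appointed IDS \<Pi> (simulator C) M w
        (enumerate ({0} \<union> global_rounds IDS \<Pi> (simulator C) M) n))"
    unfolding rounds
    using enumerate_range[OF mono] program_appointed_simulator[OF mpc M w h(1)[OF w] indist[OF w]]
    by simp
qed

section \<open>Well-formedness of the program\<close>

lemma schema_over_head_var:
  "h \<in> set (heads C) \<Longrightarrow> schema_over \<Pi> {..<length (heads C)} \<Delta> (head_var C h)"
  by (simp add: head_var_def index_less)

lemma schema_over_local_schema: "schema_over \<Pi> X \<Delta> (local_schema x)"
  using finite_\<Pi> by (auto simp: local_schema_def schema_over_BigConj dest: set_zip_leftD)

lemma modal_depth_head_var [simp]: "modal_depth (head_var C h) = 0"
  by (simp add: head_var_def)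

lemma know_schema_ok:
  assumes "x < q"
  shows "schema_over \<Pi> {..<length (heads C)} \<Delta> (know_schema C x)" "modal_depth (know_schema C x) \<le> 1"
proof -
  have "nb x ! i < q" if "i < length (nb x)" for i
    using that set_nb[OF assms] nth_mem by blast
  then show "schema_over \<Pi> {..<length (heads C)} \<Delta> (know_schema C x)"
    by (auto simp: know_schema_def schema_over_local_schema schema_over_BigConj neighbour_schema_def
        schema_over_head_var set_heads)
  have "modal_depth (local_schema x) = 0"
    by (simp add: modal_depth_0_iff)
  then show "modal_depth (know_schema C x) \<le> 1"
    by (auto simp: know_schema_def neighbour_schema_def modal_depth_BigConj)
qed

lemma schema_over_gate_schema:
  assumes mpc: "is_mpc \<Pi> \<Delta> C" and x: "x < q"
  shows "schema_over \<Pi> {..<length (heads C)} \<Delta> (gate_schema C x g)"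
proof (cases "g \<in> set (inputs C)")
  case True
  define i where "i = index (inputs C) g"
  have i: "i < length (inputs C)" using index_less[OF True] by (simp add: i_def)
  have "(x # nb x) ! b < q" if "b < length (x # nb x)" for b
    using nth_mem[OF that] x set_nb[OF x] by auto
  \<comment> \<open>Positions past the local input exist only if states are nonempty; then the
    remainder is a valid bit number.\<close>
  moreover have "0 < state_length C" if "\<not> i < card \<Pi>"
    using that i length_inputs[OF mpc] by (auto intro: Nat.gr0I)
  ultimately have "schema_over \<Pi> {..<length (heads C)} \<Delta> (input_schema C x i)"
    by (simp add: input_schema_def Let_def schema_over_head_var set_heads)
  with True show ?thesis by (simp add: gate_schema_def i_def)
next
  case False
  then show ?thesis
    using x by (auto simp: gate_schema_def schema_over_BigConj schema_over_BigDisj gate_preds_def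
        schema_over_head_var set_heads split: gate_label.split)
qed

lemma is_program_simulator:
  fixes C :: "'g mpc"
  assumes mpc: "is_mpc \<Pi> \<Delta> C"
  shows "is_program \<Pi> \<Delta> (simulator C)"
proof -
  have circuit: "is_circuit C" using mpc by (rule circuit)
  have tick: "schema_over \<Pi> {..<length (heads C)} \<Delta> (tick C)" "modal_depth (tick C) = 0"
    by (auto simp: tick_def set_heads intro!: schema_over_head_var)
  have out: "schema_over \<Pi> {..<length (heads C)} \<Delta> (head_var C (Gate x (outputs C ! j)))"
    if "x < q" "j < state_length C" for x j
    using that outputs_gate[OF mpc] by (auto simp: set_heads gate_list[OF circuit] intro!: schema_over_head_var)
  have terminal: "schema_over \<Pi> {} \<Delta> (head_terminal C h)" "modal_depth (head_terminal C h) = 0"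
    for h :: "'g head"
    by (cases h; auto simp: schema_over_local_schema schema_over_BigDisj modal_depth_0_iff)+
  have iter: "iteration_clause_ok \<Pi> \<Delta> (length (heads C)) (head_iteration C h)"
    if "h \<in> set (heads C)" for h
  proof (cases h)
    case (Out j)
    then show ?thesis
      using that tick out know_schema_ok
      by (auto simp: set_heads schema_over_BigDisj modal_depth_BigDisj)
  next
    case (Clock i)
    then show ?thesis
      using that by (auto simp: set_heads intro!: schema_over_head_var)
  next
    case (Know x)
    then show ?thesis
      using that tick know_schema_ok[of x C] by (auto simp: set_heads intro!: schema_over_head_var)
  next
    case (State x j)
    then show ?thesis
      using that tick out by (auto simp: set_heads intro!: schema_over_head_var)
  next
    case (Gate x g)
    moreover have "modal_depth (gate_schema C x g) = 0"
      by (simp add: modal_depth_0_iff)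
    ultimately show ?thesis
      using that schema_over_gate_schema[OF mpc] by (auto simp: set_heads)
  qed
  have "state_length C \<le> length (heads C)"
    by (simp add: heads_def)
  then have "attention_heads (simulator C) \<subseteq> {..<length (heads C)}"
    "print_heads (simulator C) \<subseteq> {..<length (heads C)}"
    using mpc by (auto simp: simulator_def is_mpc_def)
  then show ?thesis
    unfolding is_program_def num_heads_simulator
    using terminal iter by (simp add: terminal_body_simulator iteration_clause_simulator)
qed

section \<open>Size of the program\<close>

lemma schema_size_head_var [simp]: "schema_size (head_var C h) = 1"
  by (simp add: head_var_def)

lemma schema_size_local_schema:
  assumes "x < q"
  shows "schema_size (local_schema x) \<le> card \<Pi> * 3 + 1"
proof -
  have "schema_size (local_schema x) \<le> length (zip (sorted_list_of_set \<Pi>) (inp x)) * (2 + 1) + 1"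
    unfolding local_schema_def by (rule schema_size_BigConj) simp
  then show ?thesis
    using length_inp[OF assms] finite_\<Pi> by simp
qed

lemma schema_size_know_schema:
  assumes "x < q"
  shows "schema_size (know_schema C x) \<le> card \<Pi> * 3 + \<Delta> * 4 + 3"
proof -
  have "schema_size (BigConj (map (neighbour_schema C x) [0..<\<Delta>])) \<le> length [0..<\<Delta>] * (3 + 1) + 1"
    by (rule schema_size_BigConj) (simp add: neighbour_schema_def)
  then show ?thesis
    using schema_size_local_schema[OF assms] by (simp add: know_schema_def)
qed

lemma schema_size_gate_schema:
  assumes "is_circuit C" "fan_in C g \<le> c"
  shows "schema_size (gate_schema C x g) \<le> c * 6 + 2"
proof (cases "g \<in> set (inputs C)")
  case True
  then show ?thesis
    by (auto simp: gate_schema_def input_schema_def Let_def bool_schema_def)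
next
  case False
  define ps where "ps = gate_preds C g"
  have "length ps \<le> c"
    using assms by (simp add: ps_def gate_preds)
  moreover have "schema_size (BigConj (map (\<lambda>h. head_var C (Gate x h)) ps)) \<le> length ps * (1 + 1) + 1"
    by (rule schema_size_BigConj) simp
  moreover have "schema_size (BigDisj (map (\<lambda>h. head_var C (Gate x h)) ps)) \<le> length ps * (1 + 4) + 2"
    by (rule schema_size_BigDisj) simp
  moreover have "schema_size (BigDisj (map (\<lambda>h. Neg (head_var C (Gate x h))) ps)) \<le> length ps * (2 + 4) + 2"
    by (rule schema_size_BigDisj) simp
  ultimately show ?thesis
    using False by (auto simp: gate_schema_def ps_def split: gate_label.split)
qed

text \<open>A generous bound for both clauses of any head; it is independent of the circuit apart
  from the fan-in bound \<open>c\<close>.\<close>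

definition head_size_bound :: "nat \<Rightarrow> nat" where
  "head_size_bound c =
     q * (card \<Pi> * 3 + 8) + q * (card \<Pi> * 3 + \<Delta> * 4 + 9) + card \<Pi> * 6 + \<Delta> * 4 + c * 6 + 20"

lemma head_size:
  assumes "is_circuit C" "\<forall>g\<in>gates C. fan_in C g \<le> c" "h \<in> set (heads C)"
  shows "schema_size (head_terminal C h) + iteration_body_size (head_iteration C h) + 2
    \<le> head_size_bound c"
proof (cases h)
  case (Out j)
  define f where "f x = Conj (local_schema x) (bool_schema (universe_state C 0 x ! j))" for x
  define k where "k x = Conj (know_schema C x) (head_var C (Gate x (outputs C ! j)))" for x
  have size_b: "schema_size (bool_schema (universe_state C 0 x ! j) :: 'p schema) \<le> 2" for x
    by simp
  have "schema_size (f x) \<le> card \<Pi> * 3 + 4" if "x < q" for x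
    using add_mono[OF schema_size_local_schema[OF that] size_b[of x]] by (simp add: f_def)
  then have "schema_size (BigDisj (map f [0..<q])) \<le> length [0..<q] * (card \<Pi> * 3 + 4 + 4) + 2"
    by (intro schema_size_BigDisj) simp
  moreover have "schema_size (k x) \<le> card \<Pi> * 3 + \<Delta> * 4 + 5" if "x < q" for x
    using schema_size_know_schema[OF that, of C] by (simp add: k_def)
  then have "schema_size (BigDisj (map k [0..<q])) \<le> length [0..<q] * (card \<Pi> * 3 + \<Delta> * 4 + 5 + 4) + 2"
    by (intro schema_size_BigDisj) simp
  ultimately show ?thesis
    unfolding Out head_terminal.simps head_iteration.simps f_def[symmetric] k_def[symmetric]
    by (simp add: tick_def head_size_bound_def add_mult_distrib2)
next
  case (Clock i)
  then show ?thesis by (simp add: head_size_bound_def bool_schema_def)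
next
  case (Know x)
  then have "x < q" using assms(3) by (simp add: set_heads)
  then show ?thesis
    using schema_size_know_schema[of x C] schema_size_local_schema[of x]
    by (simp add: Know head_size_bound_def tick_def)
next
  case (State x j)
  then show ?thesis by (simp add: head_size_bound_def tick_def bool_schema_def)
next
  case (Gate x g)
  then have "g \<in> gates C"
    using assms by (simp add: set_heads gate_list)
  then show ?thesis
    using schema_size_gate_schema[OF assms(1), of g c x] assms(2)
    by (simp add: Gate head_size_bound_def)
qed

text \<open>The number of heads is linear in the circuit size with coefficients depending on
  \<open>q\<close> only, and each head has bounded size.\<close>

lemma program_size_simulator:
  assumes mpc: "is_mpc \<Pi> \<Delta> C" and fan_in: "\<forall>g\<in>gates C. fan_in C g \<le> c"
  shows "program_size (simulator C) \<le>
    (2 + 2 * q) * head_size_bound c * circuit_size C + (1 + q) * head_size_bound c"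
proof -
  have circuit: "is_circuit C" using mpc by (rule circuit)
  define m where "m = circuit_size C"
  have "program_size (simulator C) \<le> length (heads C) * head_size_bound c"
    using sum_list_map_le[of "heads C", OF head_size[OF circuit fan_in]]
    by (simp add: program_size_def simulator_def o_def)
  also have "length (heads C) = state_length C + Suc m + q + q * state_length C + q * m"
    by (simp add: heads_def gate_list[OF circuit] m_def)
  also have "\<dots> \<le> m + Suc m + q + q * m + q * m"
    using state_length_le_size[OF circuit] unfolding m_def
    by (intro add_mono mult_le_mono) auto
  also have "\<dots> = (2 + 2 * q) * m + (1 + q)"
    by (simp add: algebra_simps)
  finally show ?thesis
    by (simp add: algebra_simps m_def)
qed

end

theorem theorem1:
  fixes IDS \<Pi> :: "'p::{linorder,countable} set" and \<Delta> :: nat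
  assumes "infinite (UNIV :: 'p set)" and "finite \<Pi>" and "1 \<le> \<Delta>"
  shows "\<exists>\<Lambda> :: 'g mpc \<Rightarrow> 'p program.
     (\<forall>C. is_mpc \<Pi> \<Delta> C \<longrightarrow>
        is_program \<Pi> \<Delta> (\<Lambda> C) \<and> communication_equivalent IDS \<Pi> \<Delta> (\<Lambda> C) C) \<and>
     (\<forall>c. \<exists>a b. \<forall>C. is_mpc \<Pi> \<Delta> C \<and> (\<forall>g\<in>gates C. fan_in C g \<le> c) \<longrightarrow>
        program_size (\<Lambda> C) \<le> a * circuit_size C + b)"
proof (rule finite_universe[OF assms(2), where ?'w = nat and IDS = IDS and \<Delta> = \<Delta>])
  fix q and inp :: "nat \<Rightarrow> bool list" and nb :: "nat \<Rightarrow> nat list"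
  assume q: "\<And>x. x < q \<Longrightarrow> length (inp x) = card \<Pi>" "\<And>x. x < q \<Longrightarrow> length (nb x) \<le> \<Delta>"
      "\<And>x. x < q \<Longrightarrow> set (nb x) \<subseteq> {..<q}"
    and universal: "\<And>M :: (nat, 'p) kripke. M \<in> model_class IDS \<Pi> \<Delta> \<Longrightarrow>
       \<exists>h. \<forall>w\<in>worlds M. h w < q \<and> inp (h w) = local_input \<Pi> M w \<and>
                       nb (h w) = map h (neighbours IDS \<Pi> M w)"
  \<comment> \<open>The universe is fixed before any circuit is chosen, so the coefficients of the
    size bound do not depend on the circuit.\<close>
  interpret universe IDS \<Pi> \<Delta> q inp nb
    using assms q by unfold_locales
  have "communication_equivalent IDS \<Pi> \<Delta> (simulator C) C" if "is_mpc \<Pi> \<Delta> C" for C :: "'g mpc"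
    using that universal by (rule communication_equivalent_simulator)
  moreover have "is_program \<Pi> \<Delta> (simulator C)" if "is_mpc \<Pi> \<Delta> C" for C :: "'g mpc"
    using that by (rule is_program_simulator)
  moreover have "\<exists>a b. \<forall>C :: 'g mpc. is_mpc \<Pi> \<Delta> C \<and> (\<forall>g\<in>gates C. fan_in C g \<le> c) \<longrightarrow>
      program_size (simulator C) \<le> a * circuit_size C + b" for c
    using program_size_simulator[of _ c] by (intro exI allI impI) auto
  ultimately show ?thesis
    by (intro exI[of _ simulator] conjI allI impI)
qed

end
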